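(* Let $I=[0,1]$, let $m$ be a finite Radon measure on $I$ with full support, and let $\mathtt{s}$ be a continuous, strictly increasing function on $I$. Let $(\mathscr{E}^{(\mathtt{s})},\mathscr{F}^{(\mathtt{s})})$ be the Dirichlet form on $L^2(I,m)$ given by \[ \mathscr{F}^{(\mathtt{s})}=\Big\{u\in L^2(I,m): u\ll \mathtt{s},\ \tfrac{du}{d\mathtt{s}}\in L^2(I,d\mathtt{s})\Big\},\qquad \mathscr{E}^{(\mathtt{s})}(u,v)=\tfrac12\int_I \tfrac{du}{d\mathtt{s}}\tfrac{dv}{d\mathtt{s}}\,d\mathtt{s}. \] For each $n\ge1$ let $0=a_1<\dots<a_{n+1}=1$ with $\max_i(a_{i+1}-a_i)\to0$, $I_n=\{a_1,\dots,a_n\}$, $m_n(\{a_i\})=m([a_i,a_{i+1}))$ for $1\le i<n$, $m_n(\{a_n\})=m([a_n,1])$, and let \[ \mathscr{E}^n(\varphi,\varphi)=\tfrac12\sum_{i=1}^{n-1}\frac{(\varphi(a_{i+1})-\varphi(a_i))^2}{\mathtt{s}(a_{i+1})-\mathtt{s}(a_i)},\qquad \mathscr{F}^n=\{\varphi\in L^2(I_n,m_n):\mathscr{E}^n(\varphi,\varphi)<\infty\}. \] Define $E_n:L^2(I_n,m_n)\to L^2(I,m)$ by $E_nv(x)=v(a_i)$ for $x\in[a_i,a_{i+1})$, $1\le i\le n$ (and $E_nv(1)=v(a_n)$), and $\pi_n:L^2(I,m)\to L^2(I_n,m_n)$ by $\pi_nu(a_i)=\frac{1}{m_n(\{a_i\})}\int_{[a_i,a_{i+1})}u\,dm$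 (with $[a_n,1]$ for $i=n$). Extend $\mathscr{E}^n(v,v)=\infty$ for $v\notin\mathscr{F}^n$ and $\mathscr{E}^{(\mathtt{s})}(u,u)=\infty$ for $u\notin\mathscr{F}^{(\mathtt{s})}$. Then $\mathscr{E}^n$ is Mosco-convergent to $\mathscr{E}^{(\mathtt{s})}$ in the generalized sense, that is: (a) if $v_n\in L^2(I_n,m_n)$, $u\in L^2(I,m)$ and $E_nv_n\to u$ weakly in $L^2(I,m)$, then $\liminf_{n\to\infty}\mathscr{E}^n(v_n,v_n)\ge\mathscr{E}^{(\mathtt{s})}(u,u)$; (b) for every $u\in L^2(I,m)$ there exist $u_n\in L^2(I_n,m_n)$ such that $E_nu_n\to u$ strongly in $L^2(I,m)$ and $\limsup_{n\to\infty}\mathscr{E}^n(u_n,u_n)\le\mathscr{E}^{(\mathtt{s})}(u,u)$.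
   Context: $u\ll\mathtt{s}$ means $u$ is absolutely continuous with respect to $\mathtt{s}$, and $du/d\mathtt{s}$ is the corresponding derivative. $(\mathscr{E}^n,\mathscr{F}^n)$ is the trace of $(\mathscr{E}^{(\mathtt{s})},\mathscr{F}^{(\mathtt{s})})$ on $I_n$. *)

theory Defs
  imports "HOL-Analysis.Analysis"
begin

definition L2 :: "real measure \<Rightarrow> (real \<Rightarrow> real) \<Rightarrow> bool" where
  "L2 M u \<longleftrightarrow> u \<in> borel_measurable M \<and> integrable M (\<lambda>x. (u x)^2)"

definition ds_measure :: "(real \<Rightarrow> real) \<Rightarrow> real measure" where
  "ds_measure s = interval_measure (\<lambda>x. s (max 0 (min 1 x)))"

text \<open>Energy of the limit form, extended by infinity outside its domain:
  u (an L^2(m) function) has a version f with f(x) = f(0) + int_[0,x] g ds on [0,1],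
  g in L^2([0,1], ds); then the energy is (1/2) int g^2 ds.  Inf of the empty set is infinity.\<close>
definition Es_energy :: "real measure \<Rightarrow> (real \<Rightarrow> real) \<Rightarrow> (real \<Rightarrow> real) \<Rightarrow> ereal" where
  "Es_energy m s u = Inf {ereal ((1/2) * (LINT y:{0..1}|ds_measure s. (g y)^2)) | f g.
      L2 m u \<and> (AE x in m. u x = f x) \<and>
      g \<in> borel_measurable borel \<and>
      set_integrable (ds_measure s) {0..1} g \<and>
      set_integrable (ds_measure s) {0..1} (\<lambda>y. (g y)^2) \<and>
      (\<forall>x\<in>{0..1}. f x = f 0 + (LINT y:{0..x}|ds_measure s. g y))}"

text \<open>Extension operator E_n: a function v on I_n (given by its values v i = v(a_i), 1 \<le> i \<le> n)
  is mapped to the step function equal to v(a_i) on [a_i, a_{i+1}), and v(a_n) at 1.\<close>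
definition En :: "(nat \<Rightarrow> nat \<Rightarrow> real) \<Rightarrow> nat \<Rightarrow> (nat \<Rightarrow> real) \<Rightarrow> real \<Rightarrow> real" where
  "En a n v x = (\<Sum>i=1..n. if a n i \<le> x \<and> x < a n (Suc i) then v i else 0)
                + (if x = 1 then v n else 0)"

text \<open>Discrete energy E^n (finite for every function on the finite set I_n, so F^n = L^2(I_n,m_n)).\<close>
definition En_energy :: "(nat \<Rightarrow> nat \<Rightarrow> real) \<Rightarrow> (real \<Rightarrow> real) \<Rightarrow> nat \<Rightarrow> (nat \<Rightarrow> real) \<Rightarrow> ereal" where
  "En_energy a s n v = ereal ((1/2) * (\<Sum>i=1..n-1.
      (v (Suc i) - v i)^2 / (s (a n (Suc i)) - s (a n i))))"

end

theory Submission
  imports Defs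
begin

text \<open>
  For (a), a function v on the grid is replaced by its interpolation affine in s, whose energy is
  the discrete energy of v and whose uniform distance from the step function is at most the square
  root of (twice the energy times the largest increment of s over a cell). Along a subsequence of
  bounded energy the interpolations therefore still converge weakly to u. Almost norm-minimal densities, subject to a
  convex constraint that forces weak convergence of the primitives to u, are Cauchy in L2(ds) by the
  parallelogram law; up to a constant, u is the primitive of their limit.

  For (b), if u has finite energy its continuous version is sampled at the grid points, and the
  energy bound on each cell is the Cauchy-Schwarz inequality; full support of m makes the continuous
  version unique, so that one sequence serves all competitors in the infimum. If u has infinite
  energy only the L2 convergence matters, and it follows from the density of continuous functions.
\<close>

section \<open>Square-integrable functions\<close>

text \<open>A step function that is not constant jumps at an interior grid point, so it is not a
  primitive of a density with respect to ds, which has no atoms. This is why lower semicontinuity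
  cannot be applied to \<open>En a n v\<close> itself and the interpolations enter: they do have
  densities, and the squared L2 norm of the density is exactly twice the discrete energy. An energy
  bound controls densities but not additive constants, and the values v(a_1) could a priori run off
  to infinity. The minimisation therefore carries each constant along with its density, and only
  after the densities converge strongly is the limiting constant recovered, by testing against the
  function 1 and dividing by the positive total mass of m. The grid function has no value at a_{n+1}
  = 1, so the interpolation is constant on the last cell and that cell carries no energy.\<close>

lemma L2D:
  assumes "L2 M f"
  shows "f \<in> borel_measurable M" "integrable M (\<lambda>x. (f x)\<^sup>2)"
  using assms by (auto simp: L2_def)

lemma L2_integrable_mult:
  assumes "L2 M f" "L2 M g"
  shows "integrable M (\<lambda>x. f x * g x)"
proof (rule Bochner_Integration.integrable_bound)
  show "integrable M (\<lambda>x. (f x)\<^sup>2 + (g x)\<^sup>2)"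
    using assms by (simp add: L2D)
  show "(\<lambda>x. f x * g x) \<in> borel_measurable M"
    using L2D(1)[OF assms(1)] L2D(1)[OF assms(2)] by measurable
  have "\<bar>x * y\<bar> \<le> \<bar>x\<^sup>2 + y\<^sup>2\<bar>" for x y :: real
  proof -
    have "0 \<le> (\<bar>x\<bar> - \<bar>y\<bar>)\<^sup>2" by simp
    then have "2 * \<bar>x * y\<bar> \<le> x\<^sup>2 + y\<^sup>2" by (simp add: power2_diff abs_mult)
    then show ?thesis by linarith
  qed
  then show "AE x in M. norm (f x * g x) \<le> norm ((f x)\<^sup>2 + (g x)\<^sup>2)"
    by simp
qed

lemma L2_cmult: "L2 M f \<Longrightarrow> L2 M (\<lambda>x. c * f x)"
  by (auto simp: L2_def power_mult_distrib)

lemma L2_add: "L2 M f \<Longrightarrow> L2 M g \<Longrightarrow> L2 M (\<lambda>x. f x + g x)"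
  using L2_integrable_mult[of M f g]
  by (auto simp: L2_def power2_sum mult.assoc)

lemma L2_diff: "L2 M f \<Longrightarrow> L2 M g \<Longrightarrow> L2 M (\<lambda>x. f x - g x)"
  using L2_add[of M f "\<lambda>x. -1 * g x"] L2_cmult[of M g "-1"] by simp

lemma L2_bounded:
  assumes "finite_measure M" "f \<in> borel_measurable M" "\<And>x. x \<in> space M \<Longrightarrow> \<bar>f x\<bar> \<le> B"
  shows "L2 M f"
proof -
  interpret finite_measure M by fact
  have "integrable M (\<lambda>x. (f x)\<^sup>2)"
  proof (rule integrable_const_bound)
    show "AE x in M. norm ((f x)\<^sup>2) \<le> B\<^sup>2"
      using assms(3) by (auto intro!: AE_I2 simp: abs_le_square_iff[symmetric]) force
  qed (use assms(2) in measurable)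
  with assms(2) show ?thesis by (simp add: L2_def)
qed

lemma L2_const: "finite_measure M \<Longrightarrow> L2 M (\<lambda>x. c)"
  by (rule L2_bounded[where B="\<bar>c\<bar>"]) auto

lemma L2_mult_indicator:
  assumes "L2 M f" "A \<in> sets M"
  shows "L2 M (\<lambda>x. indicator A x * f x)"
proof -
  have "integrable M (\<lambda>x. indicator A x *\<^sub>R (f x)\<^sup>2)"
    by (rule integrable_mult_indicator) (use assms in \<open>auto simp: L2_def\<close>)
  moreover have "(indicator A x * f x)\<^sup>2 = indicator A x *\<^sub>R (f x)\<^sup>2" for x
    by (auto simp: indicator_def)
  ultimately show ?thesis
    using assms unfolding L2_def by (auto intro!: borel_measurable_times)
qed

lemma L2_integrable:
  assumes "finite_measure M" "L2 M f"
  shows "integrable M f"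
  using L2_integrable_mult[OF assms(2) L2_const[OF assms(1), of 1]] by simp

lemma L2_Cauchy_Schwarz:
  assumes f: "L2 M f" and g: "L2 M g"
  shows "(LINT x|M. f x * g x)\<^sup>2 \<le> (LINT x|M. (f x)\<^sup>2) * (LINT x|M. (g x)\<^sup>2)"
proof -
  define A B C where "A = (LINT x|M. (f x)\<^sup>2)" and "B = (LINT x|M. (g x)\<^sup>2)"
    and "C = (LINT x|M. f x * g x)"
  have int: "integrable M (\<lambda>x. (f x)\<^sup>2)" "integrable M (\<lambda>x. (g x)\<^sup>2)" "integrable M (\<lambda>x. f x * g x)"
    using f g by (auto simp: L2D L2_integrable_mult)
  have B0: "B \<ge> 0" by (simp add: B_def)
  have *: "2 * t * C \<le> A + t\<^sup>2 * B" for t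
  proof -
    have "0 \<le> (LINT x|M. (f x - t * g x)\<^sup>2)" by simp
    also have "(\<lambda>x. (f x - t * g x)\<^sup>2) = (\<lambda>x. ((f x)\<^sup>2 + t\<^sup>2 * (g x)\<^sup>2) - (2 * t) * (f x * g x))"
      by (auto simp: power2_eq_square algebra_simps)
    also have "(LINT x|M. ((f x)\<^sup>2 + t\<^sup>2 * (g x)\<^sup>2) - (2 * t) * (f x * g x)) = A + t\<^sup>2 * B - 2 * t * C"
      using int unfolding A_def B_def C_def
      by (subst Bochner_Integration.integral_diff Bochner_Integration.integral_add; simp)+
    finally show ?thesis by simp
  qed
  show ?thesis unfolding A_def[symmetric] B_def[symmetric] C_def[symmetric]
  proof (cases "B = 0")
    case True
    have "C = 0"
    proof (rule ccontr)
      assume "C \<noteq> 0"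
      \<comment> \<open>With \<open>B = 0\<close> the inequality reads 2tC \<le> A for every t; this
        t turns it into A + 1 \<le> A.\<close>
      with *[of "(A + 1) / (2 * C)"] True show False by simp
    qed
    with True show "C\<^sup>2 \<le> A * B" by simp
  next
    case False
    with B0 have "B > 0" by simp
    \<comment> \<open>The choice t = C / B minimises the quadratic A - 2tC + t^2 B.\<close>
    with *[of "C / B"] show "C\<^sup>2 \<le> A * B"
      by (simp add: field_simps power2_eq_square)
  qed
qed

text \<open>Cauchy-Schwarz for the pair consisting of the indicator of A and f cut off to A. When M
  is ds and A is a cell, the factor \<open>measure M A\<close> is the increment of s, which is the
  denominator in the discrete energy.\<close>

lemma L2_set_Cauchy_Schwarz:
  assumes M: "finite_measure M" and f: "L2 M f" and A: "A \<in> sets M"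
  shows "(LINT x:A|M. f x)\<^sup>2 \<le> measure M A * (LINT x:A|M. (f x)\<^sup>2)"
proof -
  interpret finite_measure M by fact
  have 1: "L2 M (\<lambda>x. indicator A x)"
    using L2_mult_indicator[OF L2_const[OF M, of 1] A] by simp
  have "(LINT x|M. indicator A x * (indicator A x * f x))\<^sup>2
        \<le> (LINT x|M. (indicator A x)\<^sup>2) * (LINT x|M. (indicator A x * f x)\<^sup>2)"
    by (rule L2_Cauchy_Schwarz[OF 1 L2_mult_indicator[OF f A]])
  also have "(\<lambda>x. indicator A x * (indicator A x * f x)) = (\<lambda>x. indicator A x *\<^sub>R f x)"
    by (auto simp: indicator_def)
  also have "(\<lambda>x. (indicator A x)\<^sup>2) = (\<lambda>x. indicator A x :: real)"
    by (auto simp: indicator_def)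
  also have "(\<lambda>x. (indicator A x * f x)\<^sup>2) = (\<lambda>x. indicator A x *\<^sub>R (f x)\<^sup>2)"
    by (auto simp: indicator_def)
  finally show ?thesis
    using A sets.sets_into_space[OF A] by (simp add: set_lebesgue_integral_def Int_absorb2)
qed

lemma L2_abs_Cauchy_Schwarz:
  assumes M: "finite_measure M" and f: "L2 M f"
  shows "(LINT x|M. \<bar>f x\<bar>)\<^sup>2 \<le> measure M (space M) * (LINT x|M. (f x)\<^sup>2)"
proof -
  have "L2 M (\<lambda>x. \<bar>f x\<bar>)" using f by (auto simp: L2_def)
  from L2_Cauchy_Schwarz[OF L2_const[OF M, of 1] this] show ?thesis by simp
qed

lemma L2_sum:
  assumes "finite_measure M" "finite I" "\<And>i. i \<in> I \<Longrightarrow> L2 M (f i)"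
  shows "L2 M (\<lambda>x. \<Sum>i\<in>I. f i x)"
  using assms(2,3) by (induction I) (auto intro: L2_const[OF assms(1)] L2_add)

lemma L2_square_add_le:
  assumes "L2 M f" "L2 M g"
  shows "(LINT x|M. (f x + g x)\<^sup>2) \<le> 2 * (LINT x|M. (f x)\<^sup>2) + 2 * (LINT x|M. (g x)\<^sup>2)"
proof -
  have "(LINT x|M. (f x + g x)\<^sup>2) \<le> (LINT x|M. 2 * (f x)\<^sup>2 + 2 * (g x)\<^sup>2)"
  proof (rule integral_mono)
    show "(f x + g x)\<^sup>2 \<le> 2 * (f x)\<^sup>2 + 2 * (g x)\<^sup>2" for x
    proof -
      have "0 \<le> (f x - g x)\<^sup>2" by simp
      then show ?thesis by (simp add: power2_sum power2_diff)
    qed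
  qed (use assms L2_add[OF assms] in \<open>auto simp: L2D\<close>)
  also have "\<dots> = 2 * (LINT x|M. (f x)\<^sup>2) + 2 * (LINT x|M. (g x)\<^sup>2)"
    using assms by (simp add: L2D)
  finally show ?thesis .
qed

text \<open>Makes uniform closeness sufficient for weak convergence; it serves to exchange step
  functions, interpolations and limits of primitives under a test function.\<close>

lemma integral_uniform_diff_le:
  assumes "L2 m f" "L2 m f'" "L2 m \<phi>" "finite_measure m"
    and "\<And>x. x \<in> space m \<Longrightarrow> \<bar>f x - f' x\<bar> \<le> B"
  shows "\<bar>(LINT x|m. f x * \<phi> x) - (LINT x|m. f' x * \<phi> x)\<bar> \<le> B * (LINT x|m. \<bar>\<phi> x\<bar>)"
proof -
  have int: "integrable m (\<lambda>x. f x * \<phi> x)" "integrable m (\<lambda>x. f' x * \<phi> x)" "integrable m \<phi>"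
    using assms by (auto intro: L2_integrable_mult L2_integrable)
  have "(LINT x|m. f x * \<phi> x) - (LINT x|m. f' x * \<phi> x) = (LINT x|m. f x * \<phi> x - f' x * \<phi> x)"
    using int by simp
  also have "\<bar>\<dots>\<bar> \<le> (LINT x|m. norm (f x * \<phi> x - f' x * \<phi> x))"
    using integral_norm_bound by fastforce
  also have "\<dots> \<le> (LINT x|m. B * \<bar>\<phi> x\<bar>)"
  proof (rule integral_mono)
    show "norm (f x * \<phi> x - f' x * \<phi> x) \<le> B * \<bar>\<phi> x\<bar>" if "x \<in> space m" for x
      using mult_right_mono[OF assms(5)[OF that], of "\<bar>\<phi> x\<bar>"]
      by (simp add: left_diff_distrib[symmetric] abs_mult)
  qed (use int in auto)
  finally show ?thesis by simp
qed

text \<open>Riesz-Fischer: on a finite measure space a fast subsequence has summable increments in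
  L1, hence converges almost everywhere, and Fatou's lemma turns the Cauchy bounds into bounds on
  the distance of the whole sequence to that pointwise limit.\<close>

lemma L2_complete:
  assumes M: "finite_measure M" and h: "\<And>k. L2 M (h k)"
    and Cauchy: "\<And>e. e > 0 \<Longrightarrow> \<exists>N. \<forall>i\<ge>N. \<forall>j\<ge>N. (LINT x|M. (h i x - h j x)\<^sup>2) < e"
  obtains g where "L2 M g" "(\<lambda>n. LINT x|M. (h n x - g x)\<^sup>2) \<longlonglongrightarrow> 0"
proof -
  interpret finite_measure M by fact
  note [measurable] = L2D(1)[OF h]
  have "\<forall>k. \<exists>N. \<forall>i\<ge>N. \<forall>j\<ge>N. (LINT x|M. (h i x - h j x)\<^sup>2) < (1/4)^k"
    using Cauchy by simp
  then obtain N where N: "\<And>k i j. i \<ge> N k \<Longrightarrow> j \<ge> N k \<Longrightarrow> (LINT x|M. (h i x - h j x)\<^sup>2) < (1/4)^k"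
    by metis
  \<comment> \<open>A running sum of the thresholds dominates each of them, and the summand
    \<open>k\<close> gives \<open>r k\<close> \<ge> \<open>k\<close>, so that late indices of the
    subsequence are late in the sequence.\<close>
  define r where "r k = k + (\<Sum>i\<le>k. N i)" for k
  have rN: "r j \<ge> N k" if "j \<ge> k" for j k
  proof -
    have "N k \<le> (\<Sum>i\<le>j. N i)" using that by (intro member_le_sum) auto
    then show ?thesis by (simp add: r_def)
  qed
  define d where "d k x = h (r (Suc k)) x - h (r k) x" for k x
  have dL2: "L2 M (d k)" for k unfolding d_def by (intro L2_diff h)
  note [measurable] = L2D(1)[OF dL2]
  have d_int: "integrable M (d k)" for k by (rule L2_integrable[OF M dL2])
  define c where "c = sqrt (measure M (space M))"
  have d_L1: "(LINT x|M. \<bar>d k x\<bar>) \<le> c * (1/2)^k" for k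
  proof -
    have "(LINT x|M. (d k x)\<^sup>2) \<le> (1/4)^k"
      unfolding d_def using N[of k "r (Suc k)" "r k"] rN by simp
    then have "(LINT x|M. \<bar>d k x\<bar>)\<^sup>2 \<le> measure M (space M) * (1/4)^k"
      using L2_abs_Cauchy_Schwarz[OF M dL2[of k]] by (meson dual_order.trans measure_nonneg mult_left_mono)
    also have "\<dots> = (c * (1/2)^k)\<^sup>2"
      by (simp add: c_def power_mult_distrib power_mult[symmetric] mult.commute[of k])
         (simp add: power_mult power_divide)
    finally show ?thesis
      by (rule power2_le_imp_le) (simp add: c_def)
  qed
  have "(\<integral>\<^sup>+x. (\<Sum>k. ennreal \<bar>d k x\<bar>) \<partial>M) = (\<Sum>k. \<integral>\<^sup>+x. ennreal \<bar>d k x\<bar> \<partial>M)"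
    by (rule nn_integral_suminf) measurable
  also have "\<dots> = (\<Sum>k. ennreal (LINT x|M. \<bar>d k x\<bar>))"
    using d_int by (subst nn_integral_eq_integral) auto
  also have "\<dots> \<le> (\<Sum>k. ennreal (c * (1/2)^k))"
    by (intro suminf_le ennreal_leI d_L1) auto
  also have "\<dots> < \<infinity>"
  proof -
    have "summable (\<lambda>k. c * (1/2)^k)" by (intro summable_mult summable_geometric) simp
    then show ?thesis
      by (subst suminf_ennreal2) (auto simp: c_def)
  qed
  finally have "(\<integral>\<^sup>+x. (\<Sum>k. ennreal \<bar>d k x\<bar>) \<partial>M) \<noteq> \<infinity>" by simp
  then have "AE x in M. (\<Sum>k. ennreal \<bar>d k x\<bar>) \<noteq> \<infinity>"
    by (intro nn_integral_PInf_AE) auto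
  then have conv: "AE x in M. convergent (\<lambda>k. h (r k) x)"
  proof eventually_elim
    case (elim x)
    then have "summable (\<lambda>k. \<bar>d k x\<bar>)"
      by (intro summable_suminf_not_top) auto
    then have "summable (\<lambda>k. d k x)" by (rule summable_rabs_cancel)
    then have "summable (\<lambda>k. h (r (Suc k)) x - h (r k) x)" by (simp add: d_def)
    then have "convergent (\<lambda>n. \<Sum>k<n. h (r (Suc k)) x - h (r k) x)"
      by (simp add: summable_iff_convergent)
    then have "convergent (\<lambda>n. h (r n) x - h (r 0) x)"
      by (simp add: sum_lessThan_telescope[of "\<lambda>k. h (r k) x"])
    then show ?case
      by (simp add: convergent_diff_const_right_iff)
  qed
  \<comment> \<open>\<open>lim\<close> has an unspecified value where the subsequence diverges,
    which happens on a null set only.\<close>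
  define g where "g x = lim (\<lambda>k. h (r k) x)" for x
  have g_meas[measurable]: "g \<in> borel_measurable M"
    unfolding g_def by measurable
  have fatou: "(\<integral>\<^sup>+x. ennreal ((h n x - g x)\<^sup>2) \<partial>M) \<le> ennreal e"
    if ev: "\<And>k. k \<ge> K \<Longrightarrow> (LINT x|M. (h n x - h (r k) x)\<^sup>2) \<le> e" for n e K
  proof -
    have "(\<integral>\<^sup>+x. ennreal ((h n x - g x)\<^sup>2) \<partial>M)
        = (\<integral>\<^sup>+x. liminf (\<lambda>k. ennreal ((h n x - h (r k) x)\<^sup>2)) \<partial>M)"
    proof (rule nn_integral_cong_AE)
      show "AE x in M. ennreal ((h n x - g x)\<^sup>2) = liminf (\<lambda>k. ennreal ((h n x - h (r k) x)\<^sup>2))"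
        using conv
      proof eventually_elim
        case (elim x)
        then have "(\<lambda>k. h (r k) x) \<longlonglongrightarrow> g x" by (simp add: g_def convergent_LIMSEQ_iff)
        then have "(\<lambda>k. ennreal ((h n x - h (r k) x)\<^sup>2)) \<longlonglongrightarrow> ennreal ((h n x - g x)\<^sup>2)"
          by (intro tendsto_intros)
        then show ?case using lim_imp_Liminf[OF sequentially_bot] by fastforce
      qed
    qed
    also have "\<dots> \<le> liminf (\<lambda>k. \<integral>\<^sup>+x. ennreal ((h n x - h (r k) x)\<^sup>2) \<partial>M)"
      by (rule nn_integral_liminf) measurable
    also have "\<dots> \<le> ennreal e"
    proof (rule Liminf_le)
      show "\<forall>\<^sub>F k in sequentially. (\<integral>\<^sup>+x. ennreal ((h n x - h (r k) x)\<^sup>2) \<partial>M) \<le> ennreal e"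
        using eventually_ge_at_top[of K]
      proof eventually_elim
        case (elim k)
        have "integrable M (\<lambda>x. (h n x - h (r k) x)\<^sup>2)"
          using L2_diff[OF h h] by (simp add: L2_def)
        then show ?case using ev[OF elim] by (subst nn_integral_eq_integral) (auto intro: ennreal_leI)
      qed
    qed simp
    finally show ?thesis .
  qed
  \<comment> \<open>Fatou bounds differences with g, not g itself; square integrability of g follows
    by subtracting this one difference from \<open>h (N 0)\<close>.\<close>
  have diffL2: "L2 M (\<lambda>x. h (N 0) x - g x)"
  proof -
    have "(\<integral>\<^sup>+x. ennreal ((h (N 0) x - g x)\<^sup>2) \<partial>M) \<le> ennreal 1"
      by (rule fatou[of 0]) (use N[of 0] rN[of 0] in \<open>auto intro: less_imp_le\<close>)
    then have "(\<integral>\<^sup>+x. ennreal ((h (N 0) x - g x)\<^sup>2) \<partial>M) < \<infinity>"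
      using order_le_less_trans by fastforce
    then show ?thesis
      unfolding L2_def by (auto intro!: integrableI_nonneg)
  qed
  have gL2: "L2 M g"
    using L2_diff[OF h[of "N 0"] diffL2] by simp
  have "(\<lambda>n. LINT x|M. (h n x - g x)\<^sup>2) \<longlonglongrightarrow> 0"
  proof (rule LIMSEQ_I)
    fix e :: real assume "e > 0"
    then obtain K where K: "\<And>i j. i \<ge> K \<Longrightarrow> j \<ge> K \<Longrightarrow> (LINT x|M. (h i x - h j x)\<^sup>2) < e / 2"
      using Cauchy[of "e/2"] by auto
    have "norm ((LINT x|M. (h n x - g x)\<^sup>2) - 0) < e" if "n \<ge> K" for n
    proof -
      have "(\<integral>\<^sup>+x. ennreal ((h n x - g x)\<^sup>2) \<partial>M) \<le> ennreal (e/2)"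
        by (rule fatou[of K]) (use K that in \<open>auto intro!: less_imp_le simp: r_def\<close>)
      moreover have "integrable M (\<lambda>x. (h n x - g x)\<^sup>2)"
        using L2_diff[OF h gL2] by (simp add: L2_def)
      ultimately have "(LINT x|M. (h n x - g x)\<^sup>2) \<le> e/2"
        using \<open>e > 0\<close> by (subst (asm) nn_integral_eq_integral) (auto simp: ennreal_le_iff)
      moreover have "0 \<le> (LINT x|M. (h n x - g x)\<^sup>2)" by simp
      ultimately show ?thesis using \<open>e > 0\<close> by (simp add: abs_of_nonneg)
    qed
    then show "\<exists>n0. \<forall>n\<ge>n0. norm ((LINT x|M. (h n x - g x)\<^sup>2) - 0) < e" by blast
  qed
  with gL2 that show ?thesis by blast
qed

section \<open>Almost-minimisers\<close>

lemma Inf_minimiser: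
  fixes F :: "'a \<Rightarrow> real"
  assumes "A \<noteq> {}" "\<And>x. x \<in> A \<Longrightarrow> 0 \<le> F x" "e > 0"
  shows "\<exists>x\<in>A. F x < (INF x\<in>A. F x) + e"
proof -
  have "bdd_below (F ` A)" using assms(2) by (auto intro!: bdd_belowI[of _ 0])
  then show ?thesis
    using cInf_less_iff[of "F ` A" "(INF x\<in>A. F x) + e"] assms(1,3) by auto
qed

text \<open>Replaces a diagonal argument: \<open>w n\<close> comes within 1/(n+1) of the infimum of
  \<open>D n\<close>, and the hypothesis drives these infima to 0. Candidates that depend on e are
  thereby merged into a single sequence.\<close>

lemma exists_minimising_sequence:
  fixes D :: "nat \<Rightarrow> 'a \<Rightarrow> real"
  assumes D0: "\<And>n v. 0 \<le> D n v"
    and ev: "\<And>e. e > 0 \<Longrightarrow> \<forall>\<^sub>F n in sequentially. \<exists>v. D n v < e"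
  shows "\<exists>w. (\<lambda>n. D n (w n)) \<longlonglongrightarrow> 0"
proof -
  have "\<exists>v. D n v < (INF v. D n v) + 1 / real (Suc n)" for n
    using Inf_minimiser[of UNIV "D n" "1 / real (Suc n)"] D0 by auto
  then obtain w where w: "\<And>n. D n (w n) < (INF v. D n v) + 1 / real (Suc n)" by metis
  have "(\<lambda>n. D n (w n)) \<longlonglongrightarrow> 0"
  proof (rule order_tendstoI)
    fix e :: real assume "e < 0"
    then show "\<forall>\<^sub>F n in sequentially. e < D n (w n)"
      using order.strict_trans2[OF _ D0] by (intro always_eventually allI)
  next
    fix e :: real assume "0 < e"
    then have "\<forall>\<^sub>F n in sequentially. 1 / real (Suc n) < e/2"
      by (intro order_tendstoD(2)[OF LIMSEQ_Suc[OF lim_1_over_n]]) auto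
    moreover have "\<forall>\<^sub>F n in sequentially. \<exists>v. D n v < e/2" using \<open>0 < e\<close> by (intro ev) auto
    ultimately show "\<forall>\<^sub>F n in sequentially. D n (w n) < e"
    proof eventually_elim
      case (elim n)
      then obtain v where "D n v < e/2" by blast
      moreover have "(INF v. D n v) \<le> D n v"
        using D0 by (intro cINF_lower) (auto intro!: bdd_belowI[of _ 0])
      ultimately show ?case using w[of n] elim(1) by linarith
    qed
  qed
  then show ?thesis by blast
qed

section \<open>Primitives with respect to the scale function\<close>

locale scale =
  fixes s :: "real \<Rightarrow> real"
  assumes s_cont: "continuous_on {0..1} s" and s_mono: "strict_mono_on {0..1} s"
begin

lemma s_le: "0 \<le> x \<Longrightarrow> x \<le> y \<Longrightarrow> y \<le> 1 \<Longrightarrow> s x \<le> s y"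
  using s_mono by (auto simp: strict_mono_on_def le_less)

lemma s_less: "0 \<le> x \<Longrightarrow> x < y \<Longrightarrow> y \<le> 1 \<Longrightarrow> s x < s y"
  using s_mono by (auto simp: strict_mono_on_def)

lemma clamp_mono: "x \<le> y \<Longrightarrow> s (max 0 (min 1 x)) \<le> s (max 0 (min 1 y))"
  by (rule s_le) auto

lemma clamp_cont: "continuous_on UNIV (\<lambda>x. s (max 0 (min 1 x)))"
  by (rule continuous_on_compose2[OF s_cont]) (auto intro!: continuous_intros)

lemma sets_ds [simp, measurable_cong]: "sets (ds_measure s) = sets borel"
  by (simp add: ds_measure_def)

lemma space_ds [simp]: "space (ds_measure s) = UNIV"
  by (simp add: ds_measure_def)

lemma emeasure_ds_Ioc:
  "x \<le> y \<Longrightarrow> emeasure (ds_measure s) {x<..y} = s (max 0 (min 1 y)) - s (max 0 (min 1 x))"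
  unfolding ds_measure_def
  by (rule emeasure_interval_measure_Ioc)
     (use clamp_mono clamp_cont in \<open>auto simp: continuous_on_eq_continuous_at intro: continuous_at_imp_continuous_at_within\<close>)

lemma measure_ds_Ioc:
  "0 \<le> x \<Longrightarrow> x \<le> y \<Longrightarrow> y \<le> 1 \<Longrightarrow> measure (ds_measure s) {x<..y} = s y - s x"
  using emeasure_ds_Ioc[of x y] s_le[of x y] by (simp add: measure_def)

text \<open>Clamping makes the distribution function constant outside [0,1], so every interval of
  the exhaustion already has the full mass s(1) - s(0).\<close>

lemma finite_measure_ds: "finite_measure (ds_measure s)"
proof (rule finite_measureI)
  have "(\<lambda>k. emeasure (ds_measure s) {- real (Suc k)<..real (Suc k)})
      \<longlonglongrightarrow> emeasure (ds_measure s) (\<Union>k. {- real (Suc k)<..real (Suc k)})"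
    by (rule Lim_emeasure_incseq) (auto simp: incseq_def)
  moreover have "emeasure (ds_measure s) {- real (Suc k)<..real (Suc k)} = ennreal (s 1 - s 0)" for k
    by (subst emeasure_ds_Ioc) auto
  moreover have "(\<Union>k. {- real (Suc k)<..real (Suc k)}) = UNIV"
  proof -
    have "\<exists>k. x \<in> {- real (Suc k)<..real (Suc k)}" for x
    proof -
      obtain k where "\<bar>x\<bar> < real k" using reals_Archimedean2 by blast
      then show ?thesis by (intro exI[of _ k]) auto
    qed
    then show ?thesis by blast
  qed
  ultimately have "emeasure (ds_measure s) UNIV = ennreal (s 1 - s 0)"
    by (simp add: LIMSEQ_const_iff)
  then show "emeasure (ds_measure s) (space (ds_measure s)) \<noteq> \<infinity>" by simp
qed

sublocale ds: finite_measure "ds_measure s"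
  by (rule finite_measure_ds)

section \<open>Regularity of primitives with respect to ds\<close>

abbreviation primitive :: "(real \<Rightarrow> real) \<Rightarrow> real \<Rightarrow> real" where
  "primitive h x \<equiv> (LINT y:{0..x}|ds_measure s. h y)"

lemma L2_set_integrable: "L2 (ds_measure s) h \<Longrightarrow> A \<in> sets borel \<Longrightarrow> set_integrable (ds_measure s) A h"
  unfolding set_integrable_def
  by (rule integrable_mult_indicator) (auto intro: L2_integrable[OF finite_measure_ds])

lemma L2_set_integrable_square:
  "L2 (ds_measure s) h \<Longrightarrow> A \<in> sets borel \<Longrightarrow> set_integrable (ds_measure s) A (\<lambda>y. (h y)\<^sup>2)"
  unfolding set_integrable_def
  by (rule integrable_mult_indicator) (auto simp: L2D)

lemma set_integral_square_le:
  assumes "L2 (ds_measure s) h" "A \<in> sets borel"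
  shows "(LINT y:A|ds_measure s. (h y)\<^sup>2) \<le> (LINT y|ds_measure s. (h y)\<^sup>2)"
  unfolding set_lebesgue_integral_def
  using L2_set_integrable_square[OF assms] L2D[OF assms(1)]
  by (intro integral_mono) (auto simp: set_integrable_def indicator_def)

text \<open>The clamped s is constant on [-1,0], so the point 0 is a null set of ds and the closed
  left end of the domain of integration contributes nothing.\<close>

lemma primitive_0: "L2 (ds_measure s) g \<Longrightarrow> primitive g 0 = 0"
proof -
  assume g: "L2 (ds_measure s) g"
  have "emeasure (ds_measure s) {0} \<le> emeasure (ds_measure s) {-1<..0}"
    by (rule emeasure_mono) auto
  also have "\<dots> = 0" by (subst emeasure_ds_Ioc) auto
  finally have "measure (ds_measure s) {0} = 0" by (simp add: measure_def)
  with L2_set_Cauchy_Schwarz[OF finite_measure_ds g, of "{0}"] show ?thesis by simp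
qed

lemma primitive_diff:
  assumes "L2 (ds_measure s) h" "0 \<le> x" "x \<le> y"
  shows "primitive h y - primitive h x = (LINT z:{x<..y}|ds_measure s. h z)"
proof -
  have "{0..y} = {0..x} \<union> {x<..y}" using assms by auto
  then have "primitive h y = primitive h x + (LINT z:{x<..y}|ds_measure s. h z)"
    by (simp add: set_integral_Un L2_set_integrable assms(1) ivl_disj_int)
  then show ?thesis by simp
qed

text \<open>The energy on the right is kept local to (x,y], so that estimates on disjoint cells can
  be added without loss.\<close>

lemma primitive_diff_square:
  assumes "L2 (ds_measure s) h" "0 \<le> x" "x \<le> y" "y \<le> 1"
  shows "(primitive h y - primitive h x)\<^sup>2 \<le> (s y - s x) * (LINT z:{x<..y}|ds_measure s. (h z)\<^sup>2)"
  using L2_set_Cauchy_Schwarz[OF finite_measure_ds assms(1), of "{x<..y}"] assms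
  by (simp add: primitive_diff measure_ds_Ioc)

lemma primitive_diff_le:
  assumes "L2 (ds_measure s) h" "x \<in> {0..1}" "y \<in> {0..1}"
  shows "(primitive h y - primitive h x)\<^sup>2 \<le> \<bar>s y - s x\<bar> * (LINT z|ds_measure s. (h z)\<^sup>2)"
proof -
  have *: "(primitive h y - primitive h x)\<^sup>2 \<le> \<bar>s y - s x\<bar> * (LINT z|ds_measure s. (h z)\<^sup>2)"
    if "x \<le> y" "x \<in> {0..1}" "y \<in> {0..1}" for x y
  proof -
    have "(primitive h y - primitive h x)\<^sup>2 \<le> (s y - s x) * (LINT z:{x<..y}|ds_measure s. (h z)\<^sup>2)"
      using primitive_diff_square[OF assms(1)] that by auto
    also have "\<dots> \<le> \<bar>s y - s x\<bar> * (LINT z|ds_measure s. (h z)\<^sup>2)"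
    proof (rule mult_mono)
      show "0 \<le> (LINT z:{x<..y}|ds_measure s. (h z)\<^sup>2)"
        unfolding set_lebesgue_integral_def by (rule Bochner_Integration.integral_nonneg) simp
    qed (auto intro!: set_integral_square_le assms(1))
    finally show ?thesis .
  qed
  show ?thesis
  proof (cases "x \<le> y")
    case True then show ?thesis using * assms by simp
  next
    case False then show ?thesis using *[of y x] assms
      by (simp add: power2_commute abs_minus_commute)
  qed
qed

text \<open>A primitive is Hoelder continuous of order 1/2 in the variable s(x), and s is
  continuous.\<close>

lemma primitive_continuous:
  assumes "L2 (ds_measure s) h"
  shows "continuous_on {0..1} (primitive h)"
  unfolding continuous_on_def
proof
  fix x :: real assume x: "x \<in> {0..1}"
  define C where "C = (LINT z|ds_measure s. (h z)\<^sup>2)"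
  have "((\<lambda>y. sqrt (\<bar>s y - s x\<bar> * C)) \<longlongrightarrow> sqrt (\<bar>s x - s x\<bar> * C)) (at x within {0..1})"
    using s_cont x unfolding continuous_on_def by (intro tendsto_intros) auto
  then have "((\<lambda>y. sqrt (\<bar>s y - s x\<bar> * C)) \<longlongrightarrow> 0) (at x within {0..1})" by simp
  moreover have "\<forall>\<^sub>F y in at x within {0..1}. norm (primitive h y - primitive h x) \<le> sqrt (\<bar>s y - s x\<bar> * C)"
    unfolding eventually_at_filter
    using primitive_diff_le[OF assms x] x
    by (auto intro!: always_eventually real_le_rsqrt simp: C_def)
  ultimately have "((\<lambda>y. primitive h y - primitive h x) \<longlongrightarrow> 0) (at x within {0..1})"
    by (rule Lim_null_comparison[rotated])
  then show "(primitive h \<longlongrightarrow> primitive h x) (at x within {0..1})"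
    by (simp add: LIM_zero_iff)
qed

lemma primitive_bound:
  assumes "L2 (ds_measure s) h" "x \<in> {0..1}"
  shows "\<bar>primitive h x\<bar> \<le> (LINT y|ds_measure s. \<bar>h y\<bar>)"
proof -
  have int: "integrable (ds_measure s) h" by (rule L2_integrable[OF finite_measure_ds assms(1)])
  have "\<bar>primitive h x\<bar> \<le> (LINT y|ds_measure s. norm (indicator {0..x} y *\<^sub>R h y))"
    unfolding set_lebesgue_integral_def using integral_norm_bound by fastforce
  also have "\<dots> \<le> (LINT y|ds_measure s. \<bar>h y\<bar>)"
    using int L2_set_integrable[OF assms(1), of "{0..x}"]
    by (intro integral_mono) (auto simp: set_integrable_def indicator_def)
  finally show ?thesis .
qed

lemma primitive_lincomb:
  assumes "L2 (ds_measure s) h" "L2 (ds_measure s) k"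
  shows "primitive (\<lambda>y. a * h y + b * k y) x = a * primitive h x + b * primitive k x"
  using L2_set_integrable[OF assms(1), of "{0..x}"] L2_set_integrable[OF assms(2), of "{0..x}"]
  by (subst set_integral_add) auto

lemma primitive_measurable:
  assumes "L2 (ds_measure s) h" and m: "sets m = sets (restrict_space borel {0..1})"
  shows "primitive h \<in> borel_measurable m"
proof -
  have "primitive h \<in> borel_measurable (restrict_space borel {0..1})"
    by (rule borel_measurable_continuous_on_restrict[OF primitive_continuous[OF assms(1)]])
  then show ?thesis using measurable_cong_sets[OF m refl] by blast
qed

lemma L2_primitive:
  assumes "L2 (ds_measure s) h" "finite_measure m" "sets m = sets (restrict_space borel {0..1})"
  shows "L2 m (primitive h)"
proof (rule L2_bounded[OF assms(2) primitive_measurable[OF assms(1,3)]])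
  have "space m = {0..1}" using sets_eq_imp_space_eq[OF assms(3)] by simp
  then show "\<bar>primitive h x\<bar> \<le> (LINT y|ds_measure s. \<bar>h y\<bar>)" if "x \<in> space m" for x
    using primitive_bound[OF assms(1)] that by auto
qed

text \<open>
  The minimisation runs over the pairs p = (c, h) whose primitive c + int h ds tests against every
  \<open>\<phi>\<close> at least as close to u as the tail of the sequence does. This set contains the tail and is
  closed under midpoints, which replaces weak compactness in L2(ds).
\<close>
lemma energy_lsc:
  assumes m: "finite_measure m" "sets m = sets (restrict_space borel {0..1})" "measure m (space m) > 0"
    and u: "L2 m u" and h: "\<And>k. L2 (ds_measure s) (h k)"
    and L: "\<And>k. (LINT y|ds_measure s. (h k y)\<^sup>2) \<le> L"
    and weak: "\<And>\<phi>. L2 m \<phi> \<Longrightarrow>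
      (\<lambda>k. LINT x|m. (c k + primitive (h k) x) * \<phi> x) \<longlonglongrightarrow> (LINT x|m. u x * \<phi> x)"
  obtains b g where "L2 (ds_measure s) g" "(LINT y|ds_measure s. (g y)\<^sup>2) \<le> L"
    "AE x in m. u x = b + primitive g x"
proof -
  interpret m: finite_measure m by fact
  have space_m: "space m = {0..1}" using sets_eq_imp_space_eq[OF m(2)] by simp
  define F where "F p x = fst p + primitive (snd p) x" for p :: "real \<times> (real \<Rightarrow> real)" and x
  define E where "E p = (LINT y|ds_measure s. (snd p y)\<^sup>2)" for p :: "real \<times> (real \<Rightarrow> real)"
  define \<Delta> where "\<Delta> \<phi> p = \<bar>(LINT x|m. F p x * \<phi> x) - (LINT x|m. u x * \<phi> x)\<bar>" for \<phi> p
  \<comment> \<open>The pairing with \<phi> is affine in p, so each bound on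
    \<open>\<Delta> \<phi> p\<close> confines p to a convex slab. Quantifying over all e expresses
    that \<open>\<Delta> \<phi> p\<close> is at most the supremum of
    \<open>\<Delta> \<phi> (c k, h k)\<close> over k \<ge> N, without naming that supremum.\<close>
  define A where "A N = {p. L2 (ds_measure s) (snd p) \<and>
    (\<forall>\<phi> e. L2 m \<phi> \<longrightarrow> (\<forall>k\<ge>N. \<Delta> \<phi> (c k, h k) \<le> e) \<longrightarrow> \<Delta> \<phi> p \<le> e)}" for N :: nat
  define D where "D N = (INF p\<in>A N. E p)" for N
  have AL2: "L2 (ds_measure s) (snd p)" if "p \<in> A N" for p N using that by (simp add: A_def)
  have FL2: "L2 m (F p)" if "L2 (ds_measure s) (snd p)" for p
    unfolding F_def by (intro L2_add L2_const L2_primitive m that)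
  have A_anti: "A N' \<subseteq> A N" if "N \<le> N'" for N N'
    using that unfolding A_def by (blast intro: le_trans)
  have hA: "(c N, h N) \<in> A N" for N
    using h by (auto simp: A_def)
  have E0: "0 \<le> E p" for p by (simp add: E_def)
  have bdd: "bdd_below (E ` A N)" for N using E0 by (auto intro!: bdd_belowI[of _ 0])
  have D_le: "D N \<le> E p" if "p \<in> A N" for p N
    unfolding D_def using bdd that by (rule cINF_lower)
  have D_L: "D N \<le> L" for N
    using D_le[OF hA[of N]] L[of N] by (simp add: E_def)
  \<comment> \<open>The sets \<open>A N\<close> shrink, so the infima increase; being bounded by
    \<open>L\<close> they converge, which makes almost-minimisers for different N
    comparable.\<close>
  have D_inc: "incseq D"
    unfolding incseq_def D_def
  proof (intro allI impI cINF_superset_mono)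
    show "A n \<noteq> {}" for n using hA by blast
  qed (use bdd A_anti in auto)
  obtain d where d: "D \<longlonglongrightarrow> d"
    using incseq_convergent[OF D_inc, of L] D_L by blast
  have "\<exists>p. p \<in> A N \<and> E p < D N + 1 / real (Suc N)" for N
  proof -
    have "A N \<noteq> {}" using hA by blast
    from Inf_minimiser[OF this, of E "1 / real (Suc N)"] E0 show ?thesis by (auto simp: D_def)
  qed
  then obtain p where pA: "\<And>N. p N \<in> A N" and pE: "\<And>N. E (p N) < D N + 1 / real (Suc N)"
    by metis
  have pL2: "L2 (ds_measure s) (snd (p n))" for n using AL2 pA by blast
  define mid where "mid p q = ((fst p + fst q) / 2, \<lambda>y. 1/2 * snd p y + 1/2 * snd q y)"
    for p q :: "real \<times> (real \<Rightarrow> real)"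
  have midA: "mid q q' \<in> A N" if "q \<in> A N" "q' \<in> A N" for q q' N
    unfolding A_def
  proof (intro CollectI conjI allI impI)
    show "L2 (ds_measure s) (snd (mid q q'))"
      unfolding mid_def snd_conv by (intro L2_add L2_cmult AL2[OF that(1)] AL2[OF that(2)])
    fix \<phi> e assume \<phi>: "L2 m \<phi>" and e: "\<forall>k\<ge>N. \<Delta> \<phi> (c k, h k) \<le> e"
    have q: "\<Delta> \<phi> q \<le> e" "\<Delta> \<phi> q' \<le> e" using that \<phi> e by (auto simp: A_def)
    have "F (mid q q') x * \<phi> x = 1/2 * (F q x * \<phi> x) + 1/2 * (F q' x * \<phi> x)" for x
      unfolding F_def mid_def fst_conv snd_conv
      by (subst primitive_lincomb) (use that AL2 in \<open>auto simp: field_simps\<close>)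
    moreover have "integrable m (\<lambda>x. F q x * \<phi> x)" "integrable m (\<lambda>x. F q' x * \<phi> x)"
      using that AL2 FL2 \<phi> by (blast intro: L2_integrable_mult)+
    ultimately have "(LINT x|m. F (mid q q') x * \<phi> x)
        = 1/2 * (LINT x|m. F q x * \<phi> x) + 1/2 * (LINT x|m. F q' x * \<phi> x)"
      by simp
    then show "\<Delta> \<phi> (mid q q') \<le> e" using q unfolding \<Delta>_def by linarith
  qed
  have parallelogram: "(LINT y|ds_measure s. (snd q y - snd q' y)\<^sup>2) = 2 * E q + 2 * E q' - 4 * E (mid q q')"
    if "L2 (ds_measure s) (snd q)" "L2 (ds_measure s) (snd q')" for q q'
  proof -
    have "integrable (ds_measure s) (\<lambda>y. (snd (mid q q') y)\<^sup>2)"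
      unfolding mid_def snd_conv using L2_add[OF L2_cmult[OF that(1)] L2_cmult[OF that(2)]] by (rule L2D)
    then have "(LINT y|ds_measure s. 2 * (snd q y)\<^sup>2 + 2 * (snd q' y)\<^sup>2 - 4 * (snd (mid q q') y)\<^sup>2)
        = 2 * E q + 2 * E q' - 4 * E (mid q q')"
      using L2D(2)[OF that(1)] L2D(2)[OF that(2)] by (simp add: E_def)
    also have "(\<lambda>y. 2 * (snd q y)\<^sup>2 + 2 * (snd q' y)\<^sup>2 - 4 * (snd (mid q q') y)\<^sup>2)
        = (\<lambda>y. (snd q y - snd q' y)\<^sup>2)"
      by (auto simp: mid_def power2_eq_square field_simps)
    finally show ?thesis .
  qed
  obtain g where g: "L2 (ds_measure s) g"
    and lim_g: "(\<lambda>n. LINT y|ds_measure s. (snd (p n) y - g y)\<^sup>2) \<longlonglongrightarrow> 0"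
  proof (rule L2_complete[OF finite_measure_ds pL2])
    fix e :: real assume "e > 0"
    have inv0: "(\<lambda>n. 1 / real (Suc n)) \<longlonglongrightarrow> 0" by (rule LIMSEQ_Suc[OF lim_1_over_n])
    \<comment> \<open>The midpoint of \<open>p i\<close> and \<open>p j\<close> lies in
      \<open>A N\<close>, so the squared distance is below 2(D i + 1/(i+1)) + 2(D j + 1/(j+1)) - 4 D
      N. The errors against d add up to eight times e/16 and the reciprocals to four times e/16,
      less than e in total.\<close>
    have "\<forall>\<^sub>F n in sequentially. \<bar>D n - d\<bar> < e/16 \<and> 1 / real (Suc n) < e/16"
      using tendstoD[OF d, of "e/16"] order_tendstoD(2)[OF inv0, of "e/16"] \<open>e > 0\<close>
      by (auto intro: eventually_conj simp: dist_real_def)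
    then obtain N where N: "\<And>n. n \<ge> N \<Longrightarrow> \<bar>D n - d\<bar> < e/16 \<and> 1 / real (Suc n) < e/16"
      by (auto simp: eventually_sequentially)
    have "(LINT y|ds_measure s. (snd (p i) y - snd (p j) y)\<^sup>2) < e" if "i \<ge> N" "j \<ge> N" for i j
    proof -
      have "mid (p i) (p j) \<in> A N" using A_anti that pA by (intro midA) auto
      then have "D N \<le> E (mid (p i) (p j))" by (rule D_le)
      then show ?thesis
        using parallelogram[OF pL2[of i] pL2[of j]] pE[of i] pE[of j] N[of i] N[of j] N[of N] that
        by linarith
    qed
    then show "\<exists>N. \<forall>i\<ge>N. \<forall>j\<ge>N. (LINT y|ds_measure s. (snd (p i) y - snd (p j) y)\<^sup>2) < e" by blast
  qed
  define \<epsilon> where "\<epsilon> n = (LINT y|ds_measure s. (snd (p n) y - g y)\<^sup>2)" for n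
  have \<epsilon>: "\<epsilon> \<longlonglongrightarrow> 0" using lim_g by (simp add: \<epsilon>_def[abs_def])
  have diffL2: "L2 (ds_measure s) (\<lambda>y. snd (p n) y - g y)" for n by (intro L2_diff pL2 g)
  have energy: "(LINT y|ds_measure s. (g y)\<^sup>2) \<le> L"
  proof (rule LIMSEQ_le_const)
    have "(\<lambda>n. L + 1 / real (Suc n) + 2 * sqrt ((L + 1) * \<epsilon> n) + \<epsilon> n) \<longlonglongrightarrow> L + 0 + 2 * sqrt ((L + 1) * 0) + 0"
      by (intro tendsto_intros \<epsilon> LIMSEQ_Suc[OF lim_1_over_n])
    then show "(\<lambda>n. L + 1 / real (Suc n) + 2 * sqrt ((L + 1) * \<epsilon> n) + \<epsilon> n) \<longlonglongrightarrow> L" by simp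
    \<comment> \<open>With q the density of \<open>p n\<close>, expand the square of g = q - (q - g)
      and bound the cross term \<open>I\<close> by Cauchy-Schwarz, using that the energy of
      \<open>p n\<close> is at most L + 1.\<close>
    have "(LINT y|ds_measure s. (g y)\<^sup>2) \<le> L + 1 / real (Suc n) + 2 * sqrt ((L + 1) * \<epsilon> n) + \<epsilon> n" for n
    proof -
      define I where "I = (LINT y|ds_measure s. snd (p n) y * (snd (p n) y - g y))"
      have En: "E (p n) \<le> L + 1 / real (Suc n)" using pE[of n] D_L[of n] by linarith
      moreover have "1 / real (Suc n) \<le> 1" by simp
      ultimately have "E (p n) \<le> L + 1" by linarith
      have "I\<^sup>2 \<le> E (p n) * \<epsilon> n"
        unfolding I_def E_def \<epsilon>_def by (rule L2_Cauchy_Schwarz[OF pL2 diffL2])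
      also have "\<dots> \<le> (L + 1) * \<epsilon> n"
        using \<open>E (p n) \<le> L + 1\<close> by (rule mult_right_mono) (simp add: \<epsilon>_def)
      finally have "\<bar>I\<bar> \<le> sqrt ((L + 1) * \<epsilon> n)" by (simp add: real_le_rsqrt)
      have "(LINT y|ds_measure s. (snd (p n) y)\<^sup>2 + (snd (p n) y - g y)\<^sup>2 - 2 * (snd (p n) y * (snd (p n) y - g y)))
          = E (p n) + \<epsilon> n - 2 * I"
        using L2D(2)[OF pL2[of n]] L2D(2)[OF diffL2[of n]] L2_integrable_mult[OF pL2[of n] diffL2[of n]]
        unfolding E_def \<epsilon>_def I_def by simp
      also have "(\<lambda>y. (snd (p n) y)\<^sup>2 + (snd (p n) y - g y)\<^sup>2 - 2 * (snd (p n) y * (snd (p n) y - g y))) = (\<lambda>y. (g y)\<^sup>2)"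
        by (auto simp: power2_eq_square algebra_simps)
      finally show ?thesis using En \<open>\<bar>I\<bar> \<le> _\<close> by linarith
    qed
    then show "\<exists>N. \<forall>n\<ge>N. (LINT y|ds_measure s. (g y)\<^sup>2) \<le> L + 1 / real (Suc n) + 2 * sqrt ((L + 1) * \<epsilon> n) + \<epsilon> n"
      by blast
  qed
  \<comment> \<open>The L1 distance of densities dominates the uniform distance of their primitives,
    and is itself dominated by the L2 distance because ds is finite.\<close>
  define \<delta> where "\<delta> n = (LINT y|ds_measure s. \<bar>snd (p n) y - g y\<bar>)" for n
  have \<delta>: "\<delta> \<longlonglongrightarrow> 0"
  proof (rule Lim_null_comparison)
    have "(\<lambda>n. sqrt (measure (ds_measure s) (space (ds_measure s)) * \<epsilon> n)) \<longlonglongrightarrow> sqrt (measure (ds_measure s) (space (ds_measure s)) * 0)"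
      by (intro tendsto_intros \<epsilon>)
    then show "(\<lambda>n. sqrt (measure (ds_measure s) (space (ds_measure s)) * \<epsilon> n)) \<longlonglongrightarrow> 0" by simp
    show "\<forall>\<^sub>F n in sequentially. norm (\<delta> n) \<le> sqrt (measure (ds_measure s) (space (ds_measure s)) * \<epsilon> n)"
      using L2_abs_Cauchy_Schwarz[OF finite_measure_ds diffL2]
      by (auto intro!: always_eventually real_le_rsqrt simp: \<delta>_def \<epsilon>_def)
  qed
  have unif: "\<bar>primitive (snd (p n)) x - primitive g x\<bar> \<le> \<delta> n" if "x \<in> {0..1}" for n x
  proof -
    have "primitive (\<lambda>y. snd (p n) y - g y) x = primitive (snd (p n)) x - primitive g x"
      using primitive_lincomb[OF pL2[of n] g, where a=1 and b="-1" and x=x] by simp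
    then show ?thesis using primitive_bound[OF diffL2 that, of n] by (simp add: \<delta>_def)
  qed
  have weak_p: "(\<lambda>n. LINT x|m. F (p n) x * \<phi> x) \<longlonglongrightarrow> (LINT x|m. u x * \<phi> x)" if \<phi>: "L2 m \<phi>" for \<phi>
  proof (rule LIMSEQ_I)
    fix e :: real assume "e > 0"
    then obtain N where N: "\<And>k. k \<ge> N \<Longrightarrow> \<Delta> \<phi> (c k, h k) < e/2"
      using LIMSEQ_D[OF weak[OF \<phi>], of "e/2"] by (auto simp: \<Delta>_def F_def)
    have "norm ((LINT x|m. F (p n) x * \<phi> x) - (LINT x|m. u x * \<phi> x)) < e" if "n \<ge> N" for n
    proof -
      \<comment> \<open>Here the constraint pays off: what the tail satisfies from n on, every
        element of \<open>A n\<close> satisfies as well.\<close>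
      have "\<forall>k\<ge>n. \<Delta> \<phi> (c k, h k) \<le> e/2" using N that by (auto intro!: less_imp_le)
      then have "\<Delta> \<phi> (p n) \<le> e/2" using pA[of n] \<phi> unfolding A_def by blast
      then show ?thesis using \<open>e > 0\<close> by (simp add: \<Delta>_def)
    qed
    then show "\<exists>n0. \<forall>n\<ge>n0. norm ((LINT x|m. F (p n) x * \<phi> x) - (LINT x|m. u x * \<phi> x)) < e" by blast
  qed
  \<comment> \<open>The only possible constant: b + primitive of g must have the same integral
    against m as u.\<close>
  define b where "b = ((LINT x|m. u x) - (LINT x|m. primitive g x)) / measure m (space m)"
  have prim_lim: "(\<lambda>n. LINT x|m. primitive (snd (p n)) x) \<longlonglongrightarrow> (LINT x|m. primitive g x)"
  proof (rule Lim_transform2[OF tendsto_const])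
    have "(\<lambda>n. \<delta> n * (LINT x|m. \<bar>1\<bar>)) \<longlonglongrightarrow> 0 * (LINT x|m. \<bar>1\<bar>)" by (intro tendsto_intros \<delta>)
    then have "(\<lambda>n. \<delta> n * (LINT x|m. \<bar>1\<bar>)) \<longlonglongrightarrow> 0" by simp
    moreover have "\<forall>\<^sub>F n in sequentially. norm ((LINT x|m. primitive g x) - (LINT x|m. primitive (snd (p n)) x)) \<le> \<delta> n * (LINT x|m. \<bar>1\<bar>)"
    proof (intro always_eventually allI)
      fix n
      show "norm ((LINT x|m. primitive g x) - (LINT x|m. primitive (snd (p n)) x)) \<le> \<delta> n * (LINT x|m. \<bar>1\<bar>)"
        using integral_uniform_diff_le[OF L2_primitive[OF pL2[of n] m(1,2)] L2_primitive[OF g m(1,2)] L2_const[OF m(1), of 1] m(1), of "\<delta> n"] unif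
        by (simp add: space_m abs_minus_commute)
    qed
    ultimately show "(\<lambda>n. (LINT x|m. primitive g x) - (LINT x|m. primitive (snd (p n)) x)) \<longlonglongrightarrow> 0"
      by (rule Lim_null_comparison[rotated])
  qed
  have b_lim: "(\<lambda>n. fst (p n)) \<longlonglongrightarrow> b"
  proof -
    have "(\<lambda>n. ((LINT x|m. F (p n) x * 1) - (LINT x|m. primitive (snd (p n)) x)) / measure m (space m)) \<longlonglongrightarrow>
       ((LINT x|m. u x * 1) - (LINT x|m. primitive g x)) / measure m (space m)"
      by (intro tendsto_intros weak_p L2_const m prim_lim) (use m(3) in auto)
    moreover have "(LINT x|m. F (p n) x * 1) = fst (p n) * measure m (space m) + (LINT x|m. primitive (snd (p n)) x)" for n
      using L2_integrable[OF m(1) L2_primitive[OF pL2[of n] m(1,2)]] by (simp add: F_def mult.commute)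
    ultimately show ?thesis using m(3) by (simp add: b_def)
  qed
  define f where "f x = b + primitive g x" for x
  have fL2: "L2 m f" unfolding f_def by (intro L2_add L2_const L2_primitive m g)
  have weak_f: "(LINT x|m. f x * \<phi> x) = (LINT x|m. u x * \<phi> x)" if \<phi>: "L2 m \<phi>" for \<phi>
  proof (rule LIMSEQ_unique[OF _ weak_p[OF \<phi>]], rule Lim_transform2[OF tendsto_const])
    have "(\<lambda>n. (\<bar>fst (p n) - b\<bar> + \<delta> n) * (LINT x|m. \<bar>\<phi> x\<bar>)) \<longlonglongrightarrow> (\<bar>b - b\<bar> + 0) * (LINT x|m. \<bar>\<phi> x\<bar>)"
      by (intro tendsto_intros \<delta> b_lim)
    then have "(\<lambda>n. (\<bar>fst (p n) - b\<bar> + \<delta> n) * (LINT x|m. \<bar>\<phi> x\<bar>)) \<longlonglongrightarrow> 0" by simp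
    moreover have "\<forall>\<^sub>F n in sequentially. norm ((LINT x|m. f x * \<phi> x) - (LINT x|m. F (p n) x * \<phi> x)) \<le> (\<bar>fst (p n) - b\<bar> + \<delta> n) * (LINT x|m. \<bar>\<phi> x\<bar>)"
    proof (intro always_eventually allI)
      fix n
      have "\<bar>F (p n) x - f x\<bar> \<le> \<bar>fst (p n) - b\<bar> + \<delta> n" if "x \<in> space m" for x
        using unif[of x n] that unfolding F_def f_def space_m by linarith
      then show "norm ((LINT x|m. f x * \<phi> x) - (LINT x|m. F (p n) x * \<phi> x)) \<le> (\<bar>fst (p n) - b\<bar> + \<delta> n) * (LINT x|m. \<bar>\<phi> x\<bar>)"
        using integral_uniform_diff_le[OF FL2[OF pL2[of n]] fL2 \<phi> m(1)]
        by (simp add: abs_minus_commute)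
    qed
    ultimately show "(\<lambda>n. (LINT x|m. f x * \<phi> x) - (LINT x|m. F (p n) x * \<phi> x)) \<longlonglongrightarrow> 0"
      by (rule Lim_null_comparison[rotated])
  qed
  have uf: "L2 m (\<lambda>x. u x - f x)" by (rule L2_diff[OF u fL2])
  \<comment> \<open>Since f and u have equal pairings with all test functions, testing with u - f
    itself makes their squared distance vanish.\<close>
  have "(LINT x|m. u x * (u x - f x) - f x * (u x - f x)) = 0"
    using weak_f[OF uf] L2_integrable_mult[OF u uf] L2_integrable_mult[OF fL2 uf] by simp
  also have "(\<lambda>x. u x * (u x - f x) - f x * (u x - f x)) = (\<lambda>x. (u x - f x)\<^sup>2)"
    by (auto simp: power2_eq_square algebra_simps)
  finally have "AE x in m. (u x - f x)\<^sup>2 = 0"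
    using L2D(2)[OF uf] by (subst (asm) integral_nonneg_eq_0_iff_AE) auto
  then have "AE x in m. u x = b + primitive g x" by eventually_elim (simp add: f_def)
  then show thesis using that g energy by blast
qed

end

section \<open>Density of the continuous functions\<close>

locale finite_borel_unit =
  fixes m :: "real measure"
  assumes finite_m: "finite_measure m" and sets_m: "sets m = sets (restrict_space borel {0..1})"
begin

sublocale finite_measure m by (rule finite_m)

lemma space_m: "space m = {0..1}"
  using sets_eq_imp_space_eq[OF sets_m] by simp

lemma borel_measurable_m: "f \<in> borel_measurable borel \<Longrightarrow> f \<in> borel_measurable m"
  using measurable_cong_sets[OF sets_m refl] measurable_restrict_space1 by blast

lemma L2_continuous:
  assumes "continuous_on {0..1} f"
  shows "L2 m f"
proof -
  have "f \<in> borel_measurable (restrict_space borel {0..1})"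
    by (rule borel_measurable_continuous_on_restrict[OF assms])
  then have meas: "f \<in> borel_measurable m" using measurable_cong_sets[OF sets_m refl] by blast
  have "bounded (f ` {0..1})"
    by (intro compact_imp_bounded compact_continuous_image assms compact_Icc)
  then obtain B where "\<forall>x\<in>{0..1}. \<bar>f x\<bar> \<le> B" by (auto simp: bounded_iff)
  then show ?thesis using L2_bounded[OF finite_m meas] space_m by blast
qed

text \<open>Membership in L2 is bundled in because the integral of a function that is not integrable
  is 0 by convention, which would satisfy the smallness condition vacuously. The closure properties
  below extend the class from indicators to simple functions.\<close>

definition approximable :: "(real \<Rightarrow> real) \<Rightarrow> bool" where
  "approximable f \<longleftrightarrow> L2 m f \<and>
    (\<forall>e>0. \<exists>h. continuous_on {0..1} h \<and> (LINT x|m. (f x - h x)\<^sup>2) < e)"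

lemma approximable_add:
  assumes "approximable f" "approximable g"
  shows "approximable (\<lambda>x. f x + g x)"
  unfolding approximable_def
proof (intro conjI allI impI)
  show "L2 m (\<lambda>x. f x + g x)" using assms by (auto simp: approximable_def intro: L2_add)
  fix e :: real assume "e > 0"
  then have "e/4 > 0" by simp
  obtain h where h: "continuous_on {0..1} h" "(LINT x|m. (f x - h x)\<^sup>2) < e/4"
    using assms(1) \<open>e/4 > 0\<close> unfolding approximable_def by blast
  obtain k where k: "continuous_on {0..1} k" "(LINT x|m. (g x - k x)\<^sup>2) < e/4"
    using assms(2) \<open>e/4 > 0\<close> unfolding approximable_def by blast
  have "(LINT x|m. ((f x - h x) + (g x - k x))\<^sup>2) \<le> 2 * (LINT x|m. (f x - h x)\<^sup>2) + 2 * (LINT x|m. (g x - k x)\<^sup>2)"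
    using assms by (intro L2_square_add_le L2_diff L2_continuous[OF h(1)] L2_continuous[OF k(1)])
      (auto simp: approximable_def)
  also have "\<dots> < e" using h k by linarith
  also have "(\<lambda>x. ((f x - h x) + (g x - k x))\<^sup>2) = (\<lambda>x. (f x + g x - (h x + k x))\<^sup>2)"
    by (simp add: algebra_simps)
  finally show "\<exists>h. continuous_on {0..1} h \<and> (LINT x|m. (f x + g x - h x)\<^sup>2) < e"
    using h k by (intro exI[of _ "\<lambda>x. h x + k x"]) (auto intro: continuous_on_add)
qed

lemma approximable_cmult:
  assumes "approximable f"
  shows "approximable (\<lambda>x. c * f x)"
  unfolding approximable_def
proof (intro conjI allI impI)
  show "L2 m (\<lambda>x. c * f x)" using assms by (auto simp: approximable_def intro: L2_cmult)
  fix e :: real assume "e > 0"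
  \<comment> \<open>Dividing by c^2 + 1 rather than c^2 covers c = 0.\<close>
  moreover have c: "c\<^sup>2 + 1 > 0" by (rule add_nonneg_pos) auto
  ultimately have "e / (c\<^sup>2 + 1) > 0" by simp
  then obtain h where h: "continuous_on {0..1} h" "(LINT x|m. (f x - h x)\<^sup>2) < e / (c\<^sup>2 + 1)"
    using assms unfolding approximable_def by blast
  have "(\<lambda>x. (c * f x - c * h x)\<^sup>2) = (\<lambda>x. c\<^sup>2 * (f x - h x)\<^sup>2)"
    by (simp add: right_diff_distrib[symmetric] power_mult_distrib)
  then have "(LINT x|m. (c * f x - c * h x)\<^sup>2) = c\<^sup>2 * (LINT x|m. (f x - h x)\<^sup>2)" by simp
  also have "\<dots> \<le> (c\<^sup>2 + 1) * (LINT x|m. (f x - h x)\<^sup>2)" by (rule mult_right_mono) auto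
  also have "\<dots> < e" using h(2) c by (simp add: pos_less_divide_eq mult.commute)
  finally show "\<exists>h. continuous_on {0..1} h \<and> (LINT x|m. (c * f x - h x)\<^sup>2) < e"
    using h by (intro exI[of _ "\<lambda>x. c * h x"]) (auto intro: continuous_on_mult_left)
qed

lemma approximable_cong:
  assumes "approximable f" "\<And>x. x \<in> {0..1} \<Longrightarrow> f x = g x"
  shows "approximable g"
proof -
  have "(LINT x|m. (f x - h x)\<^sup>2) = (LINT x|m. (g x - h x)\<^sup>2)" for h
    using assms(2) by (intro Bochner_Integration.integral_cong) (auto simp: space_m)
  moreover have "L2 m f \<longleftrightarrow> L2 m g"
    unfolding L2_def using assms(2)
    by (intro conj_cong measurable_cong Bochner_Integration.integrable_cong) (auto simp: space_m)
  ultimately show ?thesis using assms(1) by (simp add: approximable_def)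
qed

text \<open>Inner regularity provides a compact K inside A that misses mass less than e. The
  continuous functions max(0, 1 - j dist(x,K)) decrease to the indicator of K, and dominated
  convergence gives the estimate.\<close>

lemma approximable_indicator:
  assumes A: "A \<in> sets m"
  shows "approximable (indicator A)"
  unfolding approximable_def
proof (intro conjI allI impI)
  show A_L2: "L2 m (indicator A)"
    using L2_mult_indicator[OF L2_const[OF finite_m, of 1] A] by simp
  fix e :: real assume e: "e > 0"
  show "\<exists>h. continuous_on {0..1} h \<and> (LINT x|m. (indicator A x - h x)\<^sup>2) < e"
  \<comment> \<open>A set of small mass is approximated by 0. Otherwise
    \<open>measure m A - e\<close> is nonnegative, which forces K to have positive mass and so to be
    nonempty; \<open>infdist\<close> to the empty set would be 0.\<close>
  proof (cases "measure m A < e")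
    case True
    have "(\<lambda>x. (indicator A x - 0 :: real)\<^sup>2) = indicator A" by (auto simp: indicator_def)
    then show ?thesis
      using True A sets.sets_into_space[OF A]
      by (intro exI[of _ "\<lambda>_. 0"]) (auto simp: Int_absorb2)
  next
    case False
    \<comment> \<open>The push-forward along the inclusion of [0,1] is a measure on all Borel sets
      of the line, the setting of \<open>inner_regular\<close>.\<close>
    define M' where "M' = distr m borel (\<lambda>x. x)"
    have id: "(\<lambda>x. x) \<in> borel_measurable m" by (rule borel_measurable_m) simp
    have A01: "A \<subseteq> {0..1}" using sets.sets_into_space[OF A] by (simp add: space_m)
    have A_borel: "A \<in> sets borel"
      using A unfolding sets_m by (subst (asm) sets_restrict_space_iff) auto
    have M'_eq: "emeasure M' B = emeasure m B" if "B \<in> sets borel" "B \<subseteq> {0..1}" for B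
      using that unfolding M'_def by (subst emeasure_distr[OF id]) (auto simp: space_m Int_absorb2)
    have "emeasure M' (space M') \<noteq> \<infinity>"
      unfolding M'_def by (subst emeasure_distr[OF id]) (auto simp: emeasure_eq_measure)
    then have "emeasure M' A = (SUP K \<in> {K. K \<subseteq> A \<and> compact K}. emeasure M' K)"
      using A_borel by (intro inner_regular) (auto simp: M'_def)
    moreover have "ennreal (measure m A - e) < emeasure M' A"
      using e False A_borel A01 by (simp add: M'_eq emeasure_eq_measure ennreal_less_iff)
    ultimately obtain K where K: "K \<subseteq> A" "compact K" "ennreal (measure m A - e) < emeasure M' K"
      by (auto simp: less_SUP_iff)
    have K_borel: "K \<in> sets borel" using K(2) by (auto intro: borel_compact)
    have K_sets: "K \<in> sets m"
      using K_borel K(1) A01 unfolding sets_m by (subst sets_restrict_space_iff) auto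
    have K_meas: "measure m A - e < measure m K"
      using K A01 K_borel False by (simp add: M'_eq emeasure_eq_measure ennreal_less_iff)
    have "K \<noteq> {}" using K_meas False by auto
    have K_closed: "closed K" using K(2) by (rule compact_imp_closed)
    define h where "h j x = max 0 (1 - real j * infdist x K)" for j x
    have h_cont: "continuous_on UNIV (h j)" for j
      unfolding h_def by (intro continuous_intros)
    have h01: "0 \<le> h j x" "h j x \<le> 1" for j x
      by (auto simp: h_def infdist_nonneg)
    have h_lim: "(\<lambda>j. h j x) \<longlonglongrightarrow> indicator K x" for x
    proof (cases "x \<in> K")
      case True
      then show ?thesis by (simp add: h_def)
    next
      case False
      then have pos: "infdist x K > 0"
        using K_closed \<open>K \<noteq> {}\<close> infdist_pos_not_in_closed by blast
      obtain j0 where j0: "1 / infdist x K < real j0" using reals_Archimedean2 by blast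
      have "h j x = 0" if "j \<ge> j0" for j
      proof -
        have "1 / infdist x K < real j" using j0 that by linarith
        then show ?thesis using pos by (simp add: h_def field_simps)
      qed
      then show ?thesis using False
        by (intro tendsto_eventually) (auto simp: eventually_sequentially)
    qed
    have "(\<lambda>j. LINT x|m. (indicator A x - h j x)\<^sup>2) \<longlonglongrightarrow> (LINT x|m. (indicator A x - indicator K x)\<^sup>2)"
    proof (rule integral_dominated_convergence[where w="\<lambda>_. 1"])
      have K_L2: "L2 m (indicator K)"
        using L2_mult_indicator[OF L2_const[OF finite_m, of 1] K_sets] by simp
      show "(\<lambda>x. (indicator A x - indicator K x :: real)\<^sup>2) \<in> borel_measurable m"
        using L2D(2)[OF L2_diff[OF A_L2 K_L2]] by (rule borel_measurable_integrable)
      have "L2 m (h j)" for j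
        by (rule L2_continuous) (rule continuous_on_subset[OF h_cont], simp)
      then show "(\<lambda>x. (indicator A x - h j x)\<^sup>2) \<in> borel_measurable m" for j
        using L2D(2)[OF L2_diff[OF A_L2]] by (blast intro: borel_measurable_integrable)
      show "AE x in m. (\<lambda>j. (indicator A x - h j x)\<^sup>2) \<longlonglongrightarrow> (indicator A x - indicator K x)\<^sup>2"
        by (intro AE_I2 tendsto_intros h_lim)
      have "\<bar>indicator A x - h j x\<bar> \<le> 1" for j x
        using h01[of j x] by (auto simp: indicator_def)
      then show "AE x in m. norm ((indicator A x - h j x)\<^sup>2) \<le> 1" for j
        by (auto simp: abs_square_le_1)
    qed auto
    moreover have "(LINT x|m. (indicator A x - indicator K x)\<^sup>2) < e"
    proof -
      have "(\<lambda>x. (indicator A x - indicator K x :: real)\<^sup>2) = indicator (A - K)"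
        using K(1) by (auto simp: indicator_def fun_eq_iff)
      moreover have "(A - K) \<inter> space m = A - K" using A01 by (auto simp: space_m)
      ultimately have "(LINT x|m. (indicator A x - indicator K x)\<^sup>2) = measure m (A - K)"
        by simp
      also have "\<dots> = measure m A - measure m K"
        using A K_sets K(1) by (rule finite_measure_Diff)
      finally show ?thesis using K_meas by linarith
    qed
    ultimately have "\<forall>\<^sub>F j in sequentially. (LINT x|m. (indicator A x - h j x)\<^sup>2) < e"
      by (rule order_tendstoD(2))
    then obtain j where "(LINT x|m. (indicator A x - h j x)\<^sup>2) < e"
      by (auto simp: eventually_sequentially)
    then show ?thesis
      using continuous_on_subset[OF h_cont] by blast
  qed
qed

lemma approximable_sum:
  "finite I \<Longrightarrow> (\<And>i. i \<in> I \<Longrightarrow> approximable (f i)) \<Longrightarrow> approximable (\<lambda>x. \<Sum>i\<in>I. f i x)"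
proof (induction I rule: finite_induct)
  case empty
  show ?case using approximable_cong[OF approximable_indicator[of "{}"]] by simp
next
  case (insert i I)
  then show ?case by (simp add: approximable_add)
qed

lemma approximable_simple:
  fixes f :: "real \<Rightarrow> real"
  assumes "simple_function m f"
  shows "approximable f"
proof (rule approximable_cong)
  show "approximable (\<lambda>x. \<Sum>y\<in>f ` space m. y * indicator (f -` {y} \<inter> space m) x)"
    using assms by (intro approximable_sum approximable_cmult approximable_indicator)
      (auto simp: simple_function_def)
  show "(\<Sum>y\<in>f ` space m. y * indicator (f -` {y} \<inter> space m) x) = f x" if "x \<in> {0..1}" for x
  proof -
    have "x \<in> space m" using that by (simp add: space_m)
    then have "f x = (\<Sum>y\<in>f ` space m. indicator (f -` {y} \<inter> space m) x *\<^sub>R y)"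
      by (rule simple_function_indicator_representation_banach[OF assms])
    also have "\<dots> = (\<Sum>y\<in>f ` space m. y * indicator (f -` {y} \<inter> space m) x)"
      by (rule sum.cong) (auto simp only: real_scaleR_def mult.commute)
    finally show ?thesis ..
  qed
qed

lemma continuous_dense_L2:
  assumes u: "L2 m u" and e: "e > 0"
  obtains h where "continuous_on {0..1} h" "(LINT x|m. (u x - h x)\<^sup>2) < e"
proof -
  obtain S where S0: "(\<forall>i. simple_function m (S i)) \<and> (\<forall>x\<in>space m. (\<lambda>i. S i x) \<longlonglongrightarrow> u x) \<and>
      (\<forall>i. \<forall>x\<in>space m. dist (S i x) 0 \<le> 2 * dist (u x) 0)"
    using borel_measurable_implies_sequence_metric[OF L2D(1)[OF u], of 0] by (rule exE)
  then have S: "\<And>i. simple_function m (S i)" "\<And>x. x \<in> space m \<Longrightarrow> (\<lambda>i. S i x) \<longlonglongrightarrow> u x"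
    by blast+
  have S_le: "\<bar>S i x\<bar> \<le> 2 * \<bar>u x\<bar>" if "x \<in> space m" for i x
    using S0 that by (simp add: dist_real_def)
  have S_L2: "L2 m (S i)" for i using approximable_simple[OF S(1)] by (simp add: approximable_def)
  \<comment> \<open>The simple functions satisfy |S i| \<le> 2|u|, hence |u - S i| \<le> 3|u|, and
    the square of the right-hand side is the dominating function.\<close>
  have "(\<lambda>i. LINT x|m. (u x - S i x)\<^sup>2) \<longlonglongrightarrow> (LINT x|m. (u x - u x)\<^sup>2)"
  proof (rule integral_dominated_convergence[where w="\<lambda>x. 9 * (u x)\<^sup>2"])
    show "(\<lambda>x. (u x - S i x)\<^sup>2) \<in> borel_measurable m" for i
      using L2D(2)[OF L2_diff[OF u S_L2]] by (rule borel_measurable_integrable)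
    show "integrable m (\<lambda>x. 9 * (u x)\<^sup>2)" using L2D(2)[OF u] by simp
    show "AE x in m. (\<lambda>i. (u x - S i x)\<^sup>2) \<longlonglongrightarrow> (u x - u x)\<^sup>2"
      by (intro AE_I2 tendsto_intros S(2))
    have "(u x - S i x)\<^sup>2 \<le> 9 * (u x)\<^sup>2" if "x \<in> space m" for i x
    proof -
      have "\<bar>u x - S i x\<bar> \<le> \<bar>3 * u x\<bar>" using S_le[OF that, of i] by linarith
      then have "(u x - S i x)\<^sup>2 \<le> (3 * u x)\<^sup>2" by (simp only: abs_le_square_iff)
      then show ?thesis by (simp add: power_mult_distrib)
    qed
    then show "AE x in m. norm ((u x - S i x)\<^sup>2) \<le> 9 * (u x)\<^sup>2" for i by auto
  qed auto
  then have "(\<lambda>i. LINT x|m. (u x - S i x)\<^sup>2) \<longlonglongrightarrow> 0" by simp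
  then have "\<forall>\<^sub>F i in sequentially. (LINT x|m. (u x - S i x)\<^sup>2) < e/4"
    using e by (intro order_tendstoD(2)) auto
  then obtain i where i: "(LINT x|m. (u x - S i x)\<^sup>2) < e/4" by (auto simp: eventually_sequentially)
  have "e/4 > 0" using e by simp
  then obtain h where h: "continuous_on {0..1} h" "(LINT x|m. (S i x - h x)\<^sup>2) < e/4"
    using approximable_simple[OF S(1)[of i]] unfolding approximable_def by blast
  have "(LINT x|m. ((u x - S i x) + (S i x - h x))\<^sup>2) \<le> 2 * (LINT x|m. (u x - S i x)\<^sup>2) + 2 * (LINT x|m. (S i x - h x)\<^sup>2)"
    by (intro L2_square_add_le L2_diff u S_L2 L2_continuous h)
  also have "\<dots> < e" using h i by linarith
  finally show thesis using h that by simp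
qed

end

section \<open>Discrete forms\<close>

locale partitions =
  fixes a :: "nat \<Rightarrow> nat \<Rightarrow> real"
  assumes a_first: "\<And>n. n \<ge> 1 \<Longrightarrow> a n 1 = 0"
    and a_last: "\<And>n. n \<ge> 1 \<Longrightarrow> a n (Suc n) = 1"
    and a_incr: "\<And>n i. n \<ge> 1 \<Longrightarrow> i \<in> {1..n} \<Longrightarrow> a n i < a n (Suc i)"
    and mesh: "(\<lambda>n. Max ((\<lambda>i. a n (Suc i) - a n i) ` {1..n})) \<longlonglongrightarrow> 0"
begin

lemma a_mono:
  assumes "n \<ge> 1" "1 \<le> i" "i \<le> j" "j \<le> Suc n"
  shows "a n i \<le> a n j"
  using assms(3,4)
proof (induction j rule: dec_induct)
  case (step k)
  then have "a n k < a n (Suc k)" using assms by (intro a_incr) auto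
  with step show ?case by simp
qed simp

lemma a_range:
  assumes "n \<ge> 1" "1 \<le> i" "i \<le> Suc n"
  shows "0 \<le> a n i" "a n i \<le> 1"
  using a_mono[of n 1 i] a_mono[of n i "Suc n"] a_first[of n] a_last[of n] assms by auto

text \<open>The index depends on x only and serves every grid function v. The upper bound on x is
  not strict because of x = 1, which is assigned to the last cell by the separate summand in
  \<open>En\<close>.\<close>

lemma cell:
  assumes n: "n \<ge> 1" and x: "x \<in> {0..1}"
  obtains i where "i \<in> {1..n}" "a n i \<le> x" "x \<le> a n (Suc i)" "\<And>v. En a n v x = v i"
proof (cases "x = 1")
  case True
  have "En a n v x = v n" for v
  proof -
    have "(\<Sum>i=1..n. if a n i \<le> x \<and> x < a n (Suc i) then v i else 0) = 0"
    proof (rule sum.neutral, rule ballI)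
      fix i assume "i \<in> {1..n}"
      then have "a n (Suc i) \<le> 1" by (intro a_range n) auto
      with True show "(if a n i \<le> x \<and> x < a n (Suc i) then v i else 0) = 0" by auto
    qed
    then show ?thesis using True by (simp add: En_def)
  qed
  moreover have "a n n \<le> x" "x \<le> a n (Suc n)" using a_range(2)[OF n, of n] a_last[OF n] True n by auto
  ultimately show ?thesis using that[of n] n by auto
next
  case False
  define I where "I = {i \<in> {1..n}. a n i \<le> x}"
  have I: "finite I" "I \<noteq> {}" using n x a_first[OF n] by (auto simp: I_def)
  \<comment> \<open>The cell of x < 1 starts at the last grid point not exceeding x.\<close>
  define i where "i = Max I"
  have iI: "i \<in> I" unfolding i_def using I by (rule Max_in)
  then have i: "i \<in> {1..n}" "a n i \<le> x" by (auto simp: I_def)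
  have lt: "x < a n (Suc i)"
  proof (cases "i = n")
    case True then show ?thesis using a_last[OF n] x False by auto
  next
    case False
    have "Suc i \<notin> I" using Max_ge[OF I(1), of "Suc i"] by (auto simp: i_def)
    with False i show ?thesis by (auto simp: I_def)
  qed
  have "En a n v x = v i" for v
  proof -
    have "(\<Sum>j=1..n. if a n j \<le> x \<and> x < a n (Suc j) then v j else 0) = (\<Sum>j=1..n. if j = i then v j else 0)"
    proof (rule sum.cong)
      fix j assume j: "j \<in> {1..n}"
      have "j = i" if "a n j \<le> x" "x < a n (Suc j)"
      proof (rule ccontr)
        assume "j \<noteq> i"
        then consider "Suc j \<le> i" | "Suc i \<le> j" by linarith
        then show False
          using a_mono[OF n, of "Suc j" i] a_mono[OF n, of "Suc i" j] i lt that j by cases auto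
      qed
      then have "(a n j \<le> x \<and> x < a n (Suc j)) = (j = i)" using i(2) lt by blast
      then show "(if a n j \<le> x \<and> x < a n (Suc j) then v j else 0) = (if j = i then v j else 0)"
        by (simp only:)
    qed simp
    then show ?thesis using i False by (simp add: En_def)
  qed
  then show ?thesis using that i lt by auto
qed

lemma eventually_mesh:
  assumes "e > 0"
  shows "\<forall>\<^sub>F n in sequentially. n \<ge> 1 \<and> (\<forall>i\<in>{1..n}. a n (Suc i) - a n i < e)"
  using order_tendstoD(2)[OF mesh assms] eventually_ge_at_top[of 1]
proof eventually_elim
  case (elim n)
  have "a n (Suc i) - a n i < e" if "i \<in> {1..n}" for i
    using Max_ge[of "(\<lambda>i. a n (Suc i) - a n i) ` {1..n}" "a n (Suc i) - a n i"] that elim by auto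
  with elim show ?case by blast
qed

text \<open>Uniform continuity on a compact interval. It is applied to s, to make the increments of
  s over cells small, and to a continuous h, to compare h with its samples.\<close>

lemma eventually_mesh_continuous:
  assumes h: "continuous_on {0..1} h" and "e > 0"
  shows "\<forall>\<^sub>F n in sequentially. n \<ge> 1 \<and>
    (\<forall>i\<in>{1..n}. \<forall>x\<in>{a n i..a n (Suc i)}. \<forall>y\<in>{a n i..a n (Suc i)}. \<bar>h x - h y\<bar> < (e::real))"
proof -
  have "uniformly_continuous_on {0..1} h" using h by (rule compact_uniformly_continuous) simp
  then obtain d where d: "d > 0" "\<And>x y. x \<in> {0..1} \<Longrightarrow> y \<in> {0..1} \<Longrightarrow> \<bar>x - y\<bar> < d \<Longrightarrow> \<bar>h x - h y\<bar> < e"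
    using \<open>e > 0\<close> unfolding uniformly_continuous_on_def dist_real_def by metis
  show ?thesis
    using eventually_mesh[OF d(1)]
  proof eventually_elim
    case (elim n)
    have "\<bar>h x - h y\<bar> < e"
      if i: "i \<in> {1..n}" and xy: "x \<in> {a n i..a n (Suc i)}" "y \<in> {a n i..a n (Suc i)}" for i x y
    proof (rule d(2))
      have "a n (Suc i) - a n i < d" using elim i by blast
      then show "\<bar>x - y\<bar> < d" using xy by (simp add: abs_less_iff)
      have "0 \<le> a n i" "a n (Suc i) \<le> 1" using elim i a_range by auto
      then show "x \<in> {0..1}" "y \<in> {0..1}" using xy by auto
    qed
    then show ?case using elim by blast
  qed
qed

lemma En_measurable: "En a n v \<in> borel_measurable borel"
  unfolding En_def[abs_def] by measurable

lemma En_bounded: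
  assumes "n \<ge> 1" "x \<in> {0..1}"
  shows "\<bar>En a n v x\<bar> \<le> (\<Sum>i=1..n. \<bar>v i\<bar>)"
proof -
  obtain i where "i \<in> {1..n}" "En a n v x = v i" using cell[OF assms] by metis
  then show ?thesis by (auto intro!: member_le_sum)
qed

text \<open>The half-open cells are disjoint, so evaluation at y selects one coefficient or none.
  The selected index is the same for all families c, which lets squares be taken inside the
  sum.\<close>

lemma Ioc_cases:
  assumes n: "n \<ge> 1"
  shows "(\<forall>c. (\<Sum>i=1..n-1. indicator {a n i<..a n (Suc i)} y * c i) = (0::real)) \<or>
    (\<exists>k\<in>{1..n-1}. \<forall>c. (\<Sum>i=1..n-1. indicator {a n i<..a n (Suc i)} y * c i) = (c k :: real))"
proof (cases "\<exists>k\<in>{1..n-1}. y \<in> {a n k<..a n (Suc k)}")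
  case False
  then have "(\<Sum>i=1..n-1. indicator {a n i<..a n (Suc i)} y * c i) = 0" for c :: "nat \<Rightarrow> real"
    by (intro sum.neutral) auto
  then show ?thesis by blast
next
  case True
  then obtain k where k: "k \<in> {1..n-1}" "a n k < y" "y \<le> a n (Suc k)" by auto
  have "(\<Sum>i=1..n-1. indicator {a n i<..a n (Suc i)} y * c i) = c k" for c :: "nat \<Rightarrow> real"
  proof -
    have "(\<Sum>i=1..n-1. indicator {a n i<..a n (Suc i)} y * c i) = (\<Sum>i=1..n-1. if i = k then c i else 0)"
    proof (rule sum.cong)
      fix i assume i: "i \<in> {1..n-1}"
      have "i = k" if "y \<in> {a n i<..a n (Suc i)}"
      proof (rule ccontr)
        assume "i \<noteq> k"
        then consider "Suc i \<le> k" | "Suc k \<le> i" by linarith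
        moreover have "k \<le> Suc n" "i \<le> Suc n" using k i by auto
        ultimately show False
          using a_mono[OF n, of "Suc i" k] a_mono[OF n, of "Suc k" i] k i that by cases auto
      qed
      moreover have "y \<in> {a n k<..a n (Suc k)}" using k by simp
      ultimately have "y \<in> {a n i<..a n (Suc i)} \<longleftrightarrow> i = k" by blast
      then show "indicator {a n i<..a n (Suc i)} y * c i = (if i = k then c i else 0)"
        by (simp only: indicator_def of_bool_def) simp
    qed simp
    then show ?thesis using k by simp
  qed
  with k show ?thesis by blast
qed

end

locale discrete_forms = scale s + partitions a for s :: "real \<Rightarrow> real" and a :: "nat \<Rightarrow> nat \<Rightarrow> real"
begin

section \<open>Interpolation affine in s\<close>

lemma ds_cell:
  assumes "n \<ge> 1" "i \<in> {1..n}"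
  shows "s (a n i) < s (a n (Suc i))"
    "measure (ds_measure s) {a n i<..a n (Suc i)} = s (a n (Suc i)) - s (a n i)"
proof -
  have "0 \<le> a n i" "a n i < a n (Suc i)" "a n (Suc i) \<le> 1"
    using assms a_range[of n i] a_range[of n "Suc i"] a_incr[of n i] by auto
  then show "s (a n i) < s (a n (Suc i))"
    "measure (ds_measure s) {a n i<..a n (Suc i)} = s (a n (Suc i)) - s (a n i)"
    by (auto intro: s_less measure_ds_Ioc)
qed

definition slope :: "nat \<Rightarrow> (nat \<Rightarrow> real) \<Rightarrow> nat \<Rightarrow> real" where
  "slope n v i = (v (Suc i) - v i) / (s (a n (Suc i)) - s (a n i))"

text \<open>Density with respect to ds of the interpolation. The sum stops at n - 1, leaving slope 0
  on the last cell. The intervals are open on the left, unlike the cells of \<open>En\<close>, to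
  match the intervals whose ds-measure is an increment of s.\<close>

definition step_slope :: "nat \<Rightarrow> (nat \<Rightarrow> real) \<Rightarrow> real \<Rightarrow> real" where
  "step_slope n v y = (\<Sum>i=1..n-1. indicator {a n i<..a n (Suc i)} y * slope n v i)"

lemma L2_step_slope: "L2 (ds_measure s) (step_slope n v)"
  unfolding step_slope_def[abs_def]
  by (intro L2_sum L2_mult_indicator L2_const finite_measure_ds) auto

text \<open>At most one term of the sum is nonzero at each point, so squaring acts termwise; the
  squared slope times the increment of s leaves one factor of the increment in the
  denominator.\<close>

lemma integral_step_slope_square:
  assumes n: "n \<ge> 1"
  shows "(LINT y|ds_measure s. (step_slope n v y)\<^sup>2) =
    (\<Sum>i=1..n-1. (v (Suc i) - v i)\<^sup>2 / (s (a n (Suc i)) - s (a n i)))"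
proof -
  have "(step_slope n v y)\<^sup>2 = (\<Sum>i=1..n-1. indicator {a n i<..a n (Suc i)} y * (slope n v i)\<^sup>2)" for y
    using Ioc_cases[OF n, of y] unfolding step_slope_def
  proof
    assume "\<forall>c. (\<Sum>i=1..n-1. indicator {a n i<..a n (Suc i)} y * c i) = (0::real)"
    then show "(\<Sum>i=1..n-1. indicator {a n i<..a n (Suc i)} y * slope n v i)\<^sup>2 =
      (\<Sum>i=1..n-1. indicator {a n i<..a n (Suc i)} y * (slope n v i)\<^sup>2)" by (simp only: power_zero_numeral)
  next
    assume "\<exists>k\<in>{1..n-1}. \<forall>c. (\<Sum>i=1..n-1. indicator {a n i<..a n (Suc i)} y * c i) = (c k :: real)"
    then obtain k where "\<And>c. (\<Sum>i=1..n-1. indicator {a n i<..a n (Suc i)} y * c i) = (c k :: real)" by blast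
    then show "(\<Sum>i=1..n-1. indicator {a n i<..a n (Suc i)} y * slope n v i)\<^sup>2 =
      (\<Sum>i=1..n-1. indicator {a n i<..a n (Suc i)} y * (slope n v i)\<^sup>2)" by simp
  qed
  then have "(LINT y|ds_measure s. (step_slope n v y)\<^sup>2) =
      (LINT y|ds_measure s. (\<Sum>i=1..n-1. indicator {a n i<..a n (Suc i)} y * (slope n v i)\<^sup>2))"
    by simp
  also have "\<dots> = (\<Sum>i=1..n-1. LINT y|ds_measure s. indicator {a n i<..a n (Suc i)} y * (slope n v i)\<^sup>2)"
    by (rule Bochner_Integration.integral_sum) (simp add: ds.emeasure_eq_measure)
  also have "\<dots> = (\<Sum>i=1..n-1. (v (Suc i) - v i)\<^sup>2 / (s (a n (Suc i)) - s (a n i)))"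
  proof (rule sum.cong)
    fix i assume "i \<in> {1..n-1}"
    then have "i \<in> {1..n}" by auto
    from ds_cell[OF n this] show "(LINT y|ds_measure s. indicator {a n i<..a n (Suc i)} y * (slope n v i)\<^sup>2)
        = (v (Suc i) - v i)\<^sup>2 / (s (a n (Suc i)) - s (a n i))"
      by (simp add: slope_def power2_eq_square)
  qed simp
  finally show ?thesis .
qed

lemma En_energy_eq:
  "n \<ge> 1 \<Longrightarrow> En_energy a s n v = ereal ((1/2) * (LINT y|ds_measure s. (step_slope n v y)\<^sup>2))"
  by (simp only: En_energy_def integral_step_slope_square)

text \<open>Telescoping: cells to the left of x contribute their full difference of v, the cell of x
  contributes a part proportional to the increment of s, and later cells contribute nothing.\<close>

lemma primitive_step_slope:
  assumes n: "n \<ge> 1" and i: "i \<in> {1..n}" and x: "a n i \<le> x" "x \<le> a n (Suc i)"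
  shows "v 1 + primitive (step_slope n v) x = v i + (if i < n then slope n v i * (s x - s (a n i)) else 0)"
proof -
  have "primitive (step_slope n v) x =
      (LINT y|ds_measure s. (\<Sum>j=1..n-1. indicator ({0..x} \<inter> {a n j<..a n (Suc j)}) y * slope n v j))"
    unfolding set_lebesgue_integral_def step_slope_def
    by (intro Bochner_Integration.integral_cong)
      (simp_all add: sum_distrib_left indicator_inter_arith mult.assoc del: sum_mult_of_bool_eq sum_of_bool_mult_eq sum_mult_indicator sum_indicator_mult)
  also have "\<dots> = (\<Sum>j=1..n-1. LINT y|ds_measure s. indicator ({0..x} \<inter> {a n j<..a n (Suc j)}) y * slope n v j)"
    by (rule Bochner_Integration.integral_sum) (simp add: ds.emeasure_eq_measure)
  also have "\<dots> = (\<Sum>j=1..n-1. measure (ds_measure s) ({0..x} \<inter> {a n j<..a n (Suc j)}) * slope n v j)"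
    by simp
  also have "\<dots> = (\<Sum>j=1..n-1. (if j < i then v (Suc j) - v j else 0) + (if j = i then slope n v i * (s x - s (a n i)) else 0))"
  proof (rule sum.cong)
    fix j assume "j \<in> {1..n-1}"
    then have j: "j \<in> {1..n}" "j < n" by auto
    have a0: "0 \<le> a n j" "a n (Suc j) \<le> 1" using a_range[OF n] j by auto
    consider "j < i" | "j = i" | "i < j" by linarith
    then show "measure (ds_measure s) ({0..x} \<inter> {a n j<..a n (Suc j)}) * slope n v j =
      (if j < i then v (Suc j) - v j else 0) + (if j = i then slope n v i * (s x - s (a n i)) else 0)"
    proof cases
      case 1
      then have "a n (Suc j) \<le> a n i" using i by (intro a_mono n) auto
      then have "{0..x} \<inter> {a n j<..a n (Suc j)} = {a n j<..a n (Suc j)}" using x a0 by auto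
      then show ?thesis using 1 ds_cell[OF n j(1)] by (simp add: slope_def)
    next
      case 2
      have "{0..x} \<inter> {a n j<..a n (Suc j)} = {a n j<..x}" using x a0 2 by auto
      then show ?thesis using 2 x a0 by (simp add: measure_ds_Ioc)
    next
      case 3
      then have "a n (Suc i) \<le> a n j" using i j by (intro a_mono n) auto
      then have "{0..x} \<inter> {a n j<..a n (Suc j)} = {}" using x by auto
      then show ?thesis using 3 by simp
    qed
  qed simp
  also have "\<dots> = (\<Sum>j=1..n-1. if j < i then v (Suc j) - v j else 0) + (\<Sum>j=1..n-1. if j = i then slope n v i * (s x - s (a n i)) else 0)"
    by (rule sum.distrib)
  also have "(\<Sum>j=1..n-1. if j < i then v (Suc j) - v j else 0) = (\<Sum>j\<in>{1..<i}. v (Suc j) - v j)"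
    using i by (intro sum.mono_neutral_cong_right) auto
  also have "\<dots> = v i - v 1" using i by (intro sum_Suc_diff') auto
  also have "(\<Sum>j=1..n-1. if j = i then slope n v i * (s x - s (a n i)) else 0) = (if i < n then slope n v i * (s x - s (a n i)) else 0)"
    using i by auto
  finally show ?thesis by simp
qed

text \<open>On a cell the interpolation moves away from v(a_i) by at most |v(a_{i+1}) - v(a_i)|. The
  square of this difference, divided by the increment of s, is one summand of the integral of the
  squared density and so bounded by all of it. On the last cell the two functions agree.\<close>

lemma En_primitive_diff:
  assumes n: "n \<ge> 1" and x: "x \<in> {0..1}" and d: "\<And>i. i \<in> {1..n} \<Longrightarrow> s (a n (Suc i)) - s (a n i) \<le> d"
  shows "\<bar>En a n v x - (v 1 + primitive (step_slope n v) x)\<bar> \<le> sqrt (d * (LINT y|ds_measure s. (step_slope n v y)\<^sup>2))"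
proof -
  define I where "I = (LINT y|ds_measure s. (step_slope n v y)\<^sup>2)"
  have I0: "I \<ge> 0" by (simp add: I_def)
  obtain i where i: "i \<in> {1..n}" "a n i \<le> x" "x \<le> a n (Suc i)" "En a n v x = v i"
    using cell[OF n x] by metis
  define D where "D = s (a n (Suc i)) - s (a n i)"
  have D: "0 < D" "D \<le> d" using ds_cell[OF n i(1)] d[OF i(1)] by (auto simp: D_def)
  have eq: "En a n v x - (v 1 + primitive (step_slope n v) x) = - (if i < n then slope n v i * (s x - s (a n i)) else 0)"
    using primitive_step_slope[OF n i(1-3), of v] i(4) by simp
  show ?thesis
  proof (cases "i < n")
    case False
    then show ?thesis using eq D I0 by (simp add: I_def[symmetric])
  next
    case True
    have "(v (Suc i) - v i)\<^sup>2 / D \<le> I"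
      unfolding I_def integral_step_slope_square[OF n] D_def
    proof (rule member_le_sum[where f="\<lambda>i. (v (Suc i) - v i)\<^sup>2 / (s (a n (Suc i)) - s (a n i))"])
      show "i \<in> {1..n-1}" using True i(1) by auto
      fix j assume "j \<in> {1..n-1} - {i}"
      then have "s (a n j) < s (a n (Suc j))" by (intro ds_cell n) auto
      then show "0 \<le> (v (Suc j) - v j)\<^sup>2 / (s (a n (Suc j)) - s (a n j))" by simp
    qed simp
    then have "(v (Suc i) - v i)\<^sup>2 \<le> D * I" using D by (simp add: pos_divide_le_eq mult.commute)
    also have "\<dots> \<le> d * I" using D(2) I0 by (rule mult_right_mono)
    finally have 1: "(v (Suc i) - v i)\<^sup>2 \<le> d * I" .
    have sx: "0 \<le> s x - s (a n i)" "s x - s (a n i) \<le> D"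
      using s_le[of "a n i" x] s_le[of x "a n (Suc i)"] i x a_range[OF n] by (auto simp: D_def)
    have "\<bar>slope n v i * (s x - s (a n i))\<bar> \<le> \<bar>slope n v i\<bar> * D"
      using sx by (simp add: abs_mult mult_left_mono)
    also have "\<dots> = \<bar>v (Suc i) - v i\<bar>" using D by (simp add: slope_def D_def[symmetric] abs_divide)
    also have "\<dots> \<le> sqrt (d * I)" using 1 by (intro real_le_rsqrt) simp
    finally show ?thesis using eq True by (simp add: I_def)
  qed
qed

text \<open>The local energies furnished by the estimate on each cell belong to disjoint sets, so
  they add up to at most the total energy.\<close>

lemma En_energy_restrict_le:
  assumes n: "n \<ge> 1" and g: "L2 (ds_measure s) g"
    and f: "\<And>x. x \<in> {0..1} \<Longrightarrow> f x = f 0 + primitive g x"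
  shows "En_energy a s n (\<lambda>i. f (a n i)) \<le> ereal ((1/2) * (LINT y|ds_measure s. (g y)\<^sup>2))"
proof -
  have "(f (a n (Suc i)) - f (a n i))\<^sup>2 / (s (a n (Suc i)) - s (a n i))
      \<le> (LINT y|ds_measure s. indicator {a n i<..a n (Suc i)} y * (g y)\<^sup>2)" if i: "i \<in> {1..n-1}" for i
  proof -
    have i': "i \<in> {1..n}" using i by auto
    have r: "0 \<le> a n i" "a n i \<le> a n (Suc i)" "a n (Suc i) \<le> 1"
      using a_range[OF n] a_incr[OF n i'] i' by (auto intro: less_imp_le)
    have "f (a n (Suc i)) - f (a n i) = primitive g (a n (Suc i)) - primitive g (a n i)"
      using f[of "a n (Suc i)"] f[of "a n i"] r by simp
    then have "(f (a n (Suc i)) - f (a n i))\<^sup>2 \<le> (s (a n (Suc i)) - s (a n i)) * (LINT z:{a n i<..a n (Suc i)}|ds_measure s. (g z)\<^sup>2)"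
      using primitive_diff_square[OF g r] by simp
    then show ?thesis using ds_cell(1)[OF n i']
      by (simp add: pos_divide_le_eq set_lebesgue_integral_def mult.commute)
  qed
  then have "(\<Sum>i=1..n-1. (f (a n (Suc i)) - f (a n i))\<^sup>2 / (s (a n (Suc i)) - s (a n i)))
      \<le> (\<Sum>i=1..n-1. LINT y|ds_measure s. indicator {a n i<..a n (Suc i)} y * (g y)\<^sup>2)"
    by (rule sum_mono)
  also have int: "integrable (ds_measure s) (\<lambda>y. indicator {a n i<..a n (Suc i)} y * (g y)\<^sup>2)" for i
    using L2_set_integrable_square[OF g, of "{a n i<..a n (Suc i)}"] by (simp add: set_integrable_def)
  have "(\<Sum>i=1..n-1. LINT y|ds_measure s. indicator {a n i<..a n (Suc i)} y * (g y)\<^sup>2) =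
      (LINT y|ds_measure s. (\<Sum>i=1..n-1. indicator {a n i<..a n (Suc i)} y * (g y)\<^sup>2))"
    by (rule Bochner_Integration.integral_sum[symmetric]) (rule int)
  also have "\<dots> \<le> (LINT y|ds_measure s. (g y)\<^sup>2)"
  proof (rule integral_mono)
    show "(\<Sum>i=1..n-1. indicator {a n i<..a n (Suc i)} y * (g y)\<^sup>2) \<le> (g y)\<^sup>2" for y
      using Ioc_cases[OF n, of y]
    proof
      assume "\<forall>c. (\<Sum>i=1..n-1. indicator {a n i<..a n (Suc i)} y * c i) = (0::real)"
      from spec[OF this, of "\<lambda>_. (g y)\<^sup>2"] show ?thesis by (simp only: order_refl zero_le_power2)
    next
      assume "\<exists>k\<in>{1..n-1}. \<forall>c. (\<Sum>i=1..n-1. indicator {a n i<..a n (Suc i)} y * c i) = (c k :: real)"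
      then obtain k where "\<forall>c. (\<Sum>i=1..n-1. indicator {a n i<..a n (Suc i)} y * c i) = (c k :: real)" by blast
      from spec[OF this, of "\<lambda>_. (g y)\<^sup>2"] show ?thesis by (simp only: order_refl zero_le_power2)
    qed
    show "integrable (ds_measure s) (\<lambda>y. \<Sum>i=1..n-1. indicator {a n i<..a n (Suc i)} y * (g y)\<^sup>2)"
      by (rule Bochner_Integration.integrable_sum) (rule int)
  qed (rule L2D(2)[OF g])
  finally show ?thesis by (simp add: En_energy_def)
qed

end

section \<open>Mosco convergence\<close>

locale mosco = discrete_forms s a + finite_borel_unit m
  for s :: "real \<Rightarrow> real" and a :: "nat \<Rightarrow> nat \<Rightarrow> real" and m :: "real measure" +
  assumes full_support: "\<And>x e. x \<in> {0..1} \<Longrightarrow> e > 0 \<Longrightarrow> emeasure m (ball x e \<inter> {0..1}) > 0"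
begin

lemma mass_pos: "measure m (space m) > 0"
proof -
  have "emeasure m (ball 0 2 \<inter> {0..1}) > 0" by (rule full_support) auto
  moreover have "ball 0 2 \<inter> {0..1} = space m" by (auto simp: space_m)
  ultimately show ?thesis by (simp add: emeasure_eq_measure)
qed

lemma L2_En: "n \<ge> 1 \<Longrightarrow> L2 m (En a n v)"
  by (rule L2_bounded[OF finite_m borel_measurable_m[OF En_measurable]])
    (use En_bounded in \<open>auto simp: space_m\<close>)

text \<open>If the functions differ at x, continuity makes them differ on a relative ball around x,
  and full support prevents that ball from being null.\<close>

lemma AE_eq_imp_eq:
  assumes "continuous_on {0..1} f" "continuous_on {0..1} f'" and ae: "AE x in m. f x = (f' x :: real)"
    and x: "x \<in> {0..1}"
  shows "f x = f' x"
proof (rule ccontr)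
  assume ne: "f x \<noteq> f' x"
  have "continuous_on {0..1} (\<lambda>x. f x - f' x)" by (intro continuous_on_diff assms)
  then obtain d where d: "d > 0" "\<And>y. y \<in> {0..1} \<Longrightarrow> dist y x < d \<Longrightarrow> \<bar>(f y - f' y) - (f x - f' x)\<bar> < \<bar>f x - f' x\<bar>"
    using x ne unfolding continuous_on_iff dist_real_def
    by (metis abs_le_zero_iff eq_iff_diff_eq_0 linorder_not_le)
  obtain N where N: "{x \<in> space m. f x \<noteq> f' x} \<subseteq> N" "N \<in> null_sets m"
    using AE_E2 ae by (auto elim: AE_E simp: null_sets_def)
  have "ball x d \<inter> {0..1} \<subseteq> N"
  proof
    fix y assume "y \<in> ball x d \<inter> {0..1}"
    then have "y \<in> {0..1}" "dist y x < d" by (auto simp: dist_commute)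
    from d(2)[OF this] have "f y \<noteq> f' y" by auto
    with \<open>y \<in> {0..1}\<close> N(1) show "y \<in> N" by (auto simp: space_m)
  qed
  then have "emeasure m (ball x d \<inter> {0..1}) \<le> emeasure m N"
    using N(2) by (intro emeasure_mono) auto
  then show False using full_support[OF x d(1)] N(2) by (auto simp: null_sets_def)
qed

section \<open>Lower bound for the discrete energies\<close>

lemma Es_energy_le:
  assumes "L2 m u" "L2 (ds_measure s) g" "AE x in m. u x = b + primitive g x"
  shows "Es_energy m s u \<le> ereal ((1/2) * (LINT y|ds_measure s. (g y)\<^sup>2))"
proof -
  have "Es_energy m s u \<le> ereal ((1/2) * (LINT y:{0..1}|ds_measure s. (g y)\<^sup>2))"
    unfolding Es_energy_def
  proof (rule Inf_lower, intro CollectI exI conjI)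
    show "\<forall>x\<in>{0..1}. b + primitive g x = b + primitive g 0 + primitive g x"
      using primitive_0[OF assms(2)] by simp
    show "g \<in> borel_measurable borel" using L2D(1)[OF assms(2)] by simp
  qed (use assms in \<open>auto intro: L2_set_integrable L2_set_integrable_square\<close>)
  also have "\<dots> \<le> ereal ((1/2) * (LINT y|ds_measure s. (g y)\<^sup>2))"
    using set_integral_square_le[OF assms(2), of "{0..1}"] by simp
  finally show ?thesis .
qed

lemma liminf_inequality:
  assumes u: "L2 m u" and weak: "\<And>\<phi>. L2 m \<phi> \<Longrightarrow>
    (\<lambda>n. LINT x|m. En a n (v n) x * \<phi> x) \<longlonglongrightarrow> (LINT x|m. u x * \<phi> x)"
  shows "Es_energy m s u \<le> liminf (\<lambda>n. En_energy a s n (v n))"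
proof (rule ccontr)
  assume "\<not> ?thesis"
  then have "liminf (\<lambda>n. En_energy a s n (v n)) < Es_energy m s u" by simp
  \<comment> \<open>A real number strictly between the two energies serves twice: it bounds the
    discrete energies along a subsequence, and the bound it yields for the limit energy contradicts
    its choice.\<close>
  then obtain L where L: "liminf (\<lambda>n. En_energy a s n (v n)) < ereal L" "ereal L < Es_energy m s u"
    using ereal_dense2 by blast
  have "\<exists>\<^sub>F n in sequentially. En_energy a s n (v n) < ereal L"
  proof (rule ccontr)
    assume "\<not> ?thesis"
    then have "\<forall>\<^sub>F n in sequentially. ereal L \<le> En_energy a s n (v n)"
      by (simp add: frequently_def not_less)
    then have "ereal L \<le> liminf (\<lambda>n. En_energy a s n (v n))" by (rule Liminf_bounded)
    with L(1) show False by simp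
  qed
  then have "\<exists>\<^sub>F n in sequentially. En_energy a s n (v n) < ereal L \<and> n \<ge> 1"
    using eventually_ge_at_top[of 1] by (rule frequently_eventually_frequently)
  then have "infinite {n. En_energy a s n (v n) < ereal L \<and> n \<ge> 1}"
    by (simp add: frequently_cofinite[symmetric] cofinite_eq_sequentially)
  then obtain r :: "nat \<Rightarrow> nat" where r: "strict_mono r" "\<And>k. En_energy a s (r k) (v (r k)) < ereal L" "\<And>k. r k \<ge> 1"
    using infinite_enumerate by blast
  define h where "h k = step_slope (r k) (v (r k))" for k
  define c where "c k = v (r k) 1" for k
  have h: "L2 (ds_measure s) (h k)" for k unfolding h_def by (rule L2_step_slope)
  have h_le: "(LINT y|ds_measure s. (h k y)\<^sup>2) \<le> 2 * L" for k
    using r(2)[of k] En_energy_eq[OF r(3), of k "v (r k)"] by (simp add: h_def)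
  have L0: "0 \<le> L"
  proof -
    have "0 \<le> (LINT y|ds_measure s. (h 0 y)\<^sup>2)" by simp
    with h_le[of 0] show ?thesis by linarith
  qed
  have close: "\<forall>\<^sub>F k in sequentially. \<forall>x\<in>{0..1}. \<bar>(c k + primitive (h k) x) - En a (r k) (v (r k)) x\<bar> \<le> e"
    if "e > 0" for e
  proof -
    \<comment> \<open>An increment of s of at most d gives a uniform distance of at most sqrt(d *
      2L), which this d keeps below e; the added 1 avoids division by zero when L = 0.\<close>
    define d where "d = e\<^sup>2 / (2 * L + 1)"
    have "d > 0" using that L0 by (simp add: d_def)
    have "d * (2 * L) \<le> d * (2 * L + 1)" using \<open>d > 0\<close> by simp
    also have "\<dots> = e\<^sup>2" using L0 by (simp add: d_def)
    finally have dL: "d * (2 * L) \<le> e\<^sup>2" .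
    have "\<forall>\<^sub>F k in sequentially. \<forall>i\<in>{1..r k}. \<forall>x\<in>{a (r k) i..a (r k) (Suc i)}. \<forall>y\<in>{a (r k) i..a (r k) (Suc i)}. \<bar>s x - s y\<bar> < d"
      using eventually_compose_filterlim[OF eventually_mesh_continuous[OF s_cont \<open>d > 0\<close>] filterlim_subseq[OF r(1)]]
      by eventually_elim blast
    then show ?thesis
    proof eventually_elim
      case (elim k)
      have mono: "s (a (r k) (Suc i)) - s (a (r k) i) \<le> d" if "i \<in> {1..r k}" for i
      proof -
        have "a (r k) i \<le> a (r k) (Suc i)" using a_incr[OF r(3) that] by simp
        then have "\<bar>s (a (r k) (Suc i)) - s (a (r k) i)\<bar> < d" using elim that by simp
        then show ?thesis by simp
      qed
      show ?case
      proof
        fix x :: real assume x: "x \<in> {0..1}"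
        have "\<bar>En a (r k) (v (r k)) x - (c k + primitive (h k) x)\<bar> \<le> sqrt (d * (LINT y|ds_measure s. (h k y)\<^sup>2))"
          unfolding c_def h_def by (rule En_primitive_diff[OF r(3) x mono])
        also have "\<dots> \<le> sqrt (e\<^sup>2)"
          using dL mult_left_mono[OF h_le[of k], of d] \<open>d > 0\<close> by (intro real_sqrt_le_mono) linarith
        also have "\<dots> = e" using that by simp
        finally show "\<bar>(c k + primitive (h k) x) - En a (r k) (v (r k)) x\<bar> \<le> e"
          by (simp add: abs_minus_commute)
      qed
    qed
  qed
  have F_L2: "L2 m (\<lambda>x. c k + primitive (h k) x)" for k
    by (intro L2_add L2_const L2_primitive h finite_m sets_m)
  have weak': "(\<lambda>k. LINT x|m. (c k + primitive (h k) x) * \<phi> x) \<longlonglongrightarrow> (LINT x|m. u x * \<phi> x)"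
    if \<phi>: "L2 m \<phi>" for \<phi>
  proof (rule Lim_transform)
    show "(\<lambda>k. LINT x|m. En a (r k) (v (r k)) x * \<phi> x) \<longlonglongrightarrow> (LINT x|m. u x * \<phi> x)"
      using LIMSEQ_subseq_LIMSEQ[OF weak[OF \<phi>] r(1)] by (simp add: o_def)
    show "(\<lambda>k. (LINT x|m. (c k + primitive (h k) x) * \<phi> x) - (LINT x|m. En a (r k) (v (r k)) x * \<phi> x)) \<longlonglongrightarrow> 0"
    proof (rule tendstoI)
      fix e :: real assume "e > 0"
      define P where "P = (LINT x|m. \<bar>\<phi> x\<bar>)"
      have "P \<ge> 0" by (simp add: P_def)
      \<comment> \<open>Uniform closeness e/(P + 1) costs at most eP/(P + 1) < e after testing with
        \<phi>, also when P = 0.\<close>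
      then have "e / (P + 1) > 0" using \<open>e > 0\<close> by simp
      from close[OF this]
      show "\<forall>\<^sub>F k in sequentially. dist ((LINT x|m. (c k + primitive (h k) x) * \<phi> x) - (LINT x|m. En a (r k) (v (r k)) x * \<phi> x)) 0 < e"
      proof eventually_elim
        case (elim k)
        have "\<bar>(LINT x|m. (c k + primitive (h k) x) * \<phi> x) - (LINT x|m. En a (r k) (v (r k)) x * \<phi> x)\<bar> \<le> e / (P + 1) * P"
          unfolding P_def
          by (rule integral_uniform_diff_le[OF F_L2 L2_En[OF r(3)] \<phi> finite_m])
            (use elim in \<open>auto simp: space_m P_def\<close>)
        also have "\<dots> < e" using \<open>P \<ge> 0\<close> \<open>e > 0\<close> by (simp add: pos_divide_less_eq mult_less_cancel_left_pos)
        finally show ?case by simp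
      qed
    qed
  qed
  obtain b g where g: "L2 (ds_measure s) g" "(LINT y|ds_measure s. (g y)\<^sup>2) \<le> 2 * L"
    "AE x in m. u x = b + primitive g x"
    using energy_lsc[OF finite_m sets_m mass_pos u h h_le weak'] by blast
  have "Es_energy m s u \<le> ereal ((1/2) * (LINT y|ds_measure s. (g y)\<^sup>2))"
    by (rule Es_energy_le[OF u g(1,3)])
  also have "\<dots> \<le> ereal L" using g(2) by simp
  finally show False using L(2) by simp
qed

text \<open>Samples of a continuous function on a fine grid are uniformly close to it, and m is
  finite. This provides the L2 convergence for finite as well as for infinite energy.\<close>

lemma integral_En_samples:
  assumes h: "continuous_on {0..1} h"
  shows "(\<lambda>n. LINT x|m. (En a n (\<lambda>i. h (a n i)) x - h x)\<^sup>2) \<longlonglongrightarrow> 0"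
proof (rule tendstoI)
  fix e :: real assume "e > 0"
  define M where "M = measure m (space m)"
  have M: "M > 0" unfolding M_def by (rule mass_pos)
  \<comment> \<open>Chosen so that d^2 times the total mass is e/2.\<close>
  define d where "d = sqrt (e / (2 * M))"
  have d: "d > 0" using M \<open>e > 0\<close> by (simp add: d_def)
  have d2: "d\<^sup>2 * M < e" using M \<open>e > 0\<close> by (simp add: d_def)
  show "\<forall>\<^sub>F n in sequentially. dist (LINT x|m. (En a n (\<lambda>i. h (a n i)) x - h x)\<^sup>2) 0 < e"
    using eventually_mesh_continuous[OF h d]
  proof eventually_elim
    case (elim n)
    then have n: "n \<ge> 1" by simp
    have "(En a n (\<lambda>i. h (a n i)) x - h x)\<^sup>2 \<le> d\<^sup>2" if "x \<in> space m" for x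
    proof -
      have "x \<in> {0..1}" using that by (simp add: space_m)
      then obtain i where i: "i \<in> {1..n}" "a n i \<le> x" "x \<le> a n (Suc i)" "En a n (\<lambda>i. h (a n i)) x = h (a n i)"
        using cell[OF n] by metis
      then have "\<bar>h (a n i) - h x\<bar> < d" using elim by auto
      then have "\<bar>h (a n i) - h x\<bar> \<le> \<bar>d\<bar>" using d by linarith
      then show ?thesis using i(4) by (simp add: abs_le_square_iff)
    qed
    then have "(LINT x|m. (En a n (\<lambda>i. h (a n i)) x - h x)\<^sup>2) \<le> (LINT x|m. d\<^sup>2)"
      by (intro integral_mono L2D(2)[OF L2_diff] L2_En n L2_continuous h) auto
    also have "\<dots> < e" using d2 by (simp add: M_def mult.commute)
    finally show ?case by simp
  qed
qed

text \<open>The limit form constrains g on [0,1] only. Cutting g off outside that interval yields a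
  density that is square integrable on the whole line, with the same primitive on [0,1] and the same
  energy.\<close>

lemma Es_energy_competitor:
  assumes g: "g \<in> borel_measurable borel" "set_integrable (ds_measure s) {0..1} (\<lambda>y. (g y)\<^sup>2)"
    and f: "\<forall>x\<in>{0..1}. f x = f 0 + primitive g x"
  obtains k where "L2 (ds_measure s) k" "\<And>x. x \<in> {0..1} \<Longrightarrow> f x = f 0 + primitive k x"
    "(LINT y|ds_measure s. (k y)\<^sup>2) = (LINT y:{0..1}|ds_measure s. (g y)\<^sup>2)"
proof
  define k where "k y = indicator {0..1} y * g y" for y
  have k2: "(k y)\<^sup>2 = indicator {0..1} y *\<^sub>R (g y)\<^sup>2" for y by (auto simp: k_def indicator_def)
  show "L2 (ds_measure s) k"
    unfolding L2_def k2 using g by (auto simp: k_def[abs_def] set_integrable_def)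
  have "primitive k x = primitive g x" if "x \<in> {0..1}" for x
    unfolding set_lebesgue_integral_def using that
    by (intro Bochner_Integration.integral_cong) (auto simp: k_def indicator_def)
  then show "f x = f 0 + primitive k x" if "x \<in> {0..1}" for x
    using bspec[OF f that] that by (simp only:)
  show "(LINT y|ds_measure s. (k y)\<^sup>2) = (LINT y:{0..1}|ds_measure s. (g y)\<^sup>2)"
    by (simp add: k2 set_lebesgue_integral_def)
qed

lemma recovery_sequence:
  assumes u: "L2 m u"
  shows "\<exists>w. (\<lambda>n. LINT x|m. (En a n (w n) x - u x)\<^sup>2) \<longlonglongrightarrow> 0 \<and>
    limsup (\<lambda>n. En_energy a s n (w n)) \<le> Es_energy m s u"
proof (cases "\<exists>b g. L2 (ds_measure s) g \<and> (AE x in m. u x = b + primitive g x)")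
  case True
  then obtain b g where g: "L2 (ds_measure s) g" and ug: "AE x in m. u x = b + primitive g x" by blast
  define f where "f x = b + primitive g x" for x
  have f_cont: "continuous_on {0..1} f"
    unfolding f_def by (intro continuous_intros primitive_continuous g)
  define w where "w n i = f (a n i)" for n i
  have "(\<lambda>n. LINT x|m. (En a n (w n) x - u x)\<^sup>2) \<longlonglongrightarrow> 0"
  proof (rule Lim_transform_eventually[OF integral_En_samples[OF f_cont]])
    show "\<forall>\<^sub>F n in sequentially. (LINT x|m. (En a n (\<lambda>i. f (a n i)) x - f x)\<^sup>2) = (LINT x|m. (En a n (w n) x - u x)\<^sup>2)"
      using eventually_ge_at_top[of 1]
    proof eventually_elim
      case (elim n)
      show ?case
      proof (rule integral_cong_AE)
        show "AE x in m. (En a n (\<lambda>i. f (a n i)) x - f x)\<^sup>2 = (En a n (w n) x - u x)\<^sup>2"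
          using ug by eventually_elim (simp add: f_def w_def[abs_def])
      qed (use L2D(2)[OF L2_diff[OF L2_En[OF elim] L2_continuous[OF f_cont]]]
             L2D(2)[OF L2_diff[OF L2_En[OF elim] u]] in \<open>blast intro: borel_measurable_integrable\<close>)+
    qed
  qed
  moreover have "limsup (\<lambda>n. En_energy a s n (w n)) \<le> Es_energy m s u"
    unfolding Es_energy_def
  proof (rule Inf_greatest, clarify)
    fix f' g'
    assume f': "AE x in m. u x = f' x" "\<forall>x\<in>{0..1}. f' x = f' 0 + primitive g' x"
      and g': "g' \<in> borel_measurable borel" "set_integrable (ds_measure s) {0..1} (\<lambda>y. (g' y)\<^sup>2)"
    obtain k where k: "L2 (ds_measure s) k" and f'k: "\<And>x. x \<in> {0..1} \<Longrightarrow> f' x = f' 0 + primitive k x"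
      and k_energy: "(LINT y|ds_measure s. (k y)\<^sup>2) = (LINT y:{0..1}|ds_measure s. (g' y)\<^sup>2)"
      using Es_energy_competitor[OF g' f'(2)] by blast
    have "continuous_on {0..1} (\<lambda>x. f' 0 + primitive k x)"
      by (intro continuous_intros primitive_continuous k)
    then have f'_cont: "continuous_on {0..1} f'"
      by (rule continuous_on_eq) (rule f'k[symmetric])
    \<comment> \<open>Equality is needed at every point: the energy of the samples depends on the
      values at the grid points, which may form a null set.\<close>
    have ff': "f x = f' x" if "x \<in> {0..1}" for x
    proof (rule AE_eq_imp_eq[OF f_cont f'_cont _ that])
      show "AE x in m. f x = f' x" using ug f'(1) by eventually_elim (simp add: f_def)
    qed
    have "\<forall>\<^sub>F n in sequentially. En_energy a s n (w n) \<le> ereal ((1/2) * (LINT y|ds_measure s. (k y)\<^sup>2))"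
      using eventually_ge_at_top[of 1]
    proof eventually_elim
      case (elim n)
      have "f x = f 0 + primitive k x" if "x \<in> {0..1}" for x
      proof -
        have "f 0 = f' 0" by (rule ff') simp
        then show ?thesis using f'k[OF that] ff'[OF that] by (simp only:)
      qed
      from En_energy_restrict_le[OF elim k this] show ?case by (simp add: w_def[abs_def])
    qed
    then have "limsup (\<lambda>n. En_energy a s n (w n)) \<le> ereal ((1/2) * (LINT y|ds_measure s. (k y)\<^sup>2))"
      by (rule Limsup_bounded)
    also note k_energy
    finally show "limsup (\<lambda>n. En_energy a s n (w n)) \<le> ereal ((1/2) * (LINT y:{0..1}|ds_measure s. (g' y)\<^sup>2))" .
  qed
  ultimately show ?thesis by blast
next
  case False
  \<comment> \<open>Any competitor in the infimum would supply a density of the excluded kind, so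
    the infimum is over the empty set and the limsup bound is void.\<close>
  have "\<infinity> \<le> Es_energy m s u"
    unfolding Es_energy_def
  proof (rule Inf_greatest, clarify)
    fix f g
    assume f: "AE x in m. u x = f x" "\<forall>x\<in>{0..1}. f x = f 0 + primitive g x"
      and g: "g \<in> borel_measurable borel" "set_integrable (ds_measure s) {0..1} (\<lambda>y. (g y)\<^sup>2)"
    obtain k where k: "L2 (ds_measure s) k" "\<And>x. x \<in> {0..1} \<Longrightarrow> f x = f 0 + primitive k x"
      using Es_energy_competitor[OF g f(2)] by blast
    have "AE x in m. u x = f 0 + primitive k x"
      using f(1) AE_space
    proof eventually_elim
      case (elim x)
      then show ?case using k(2)[of x] by (simp add: space_m)
    qed
    with False k(1) show "\<infinity> \<le> ereal ((1/2) * (LINT y:{0..1}|ds_measure s. (g y)\<^sup>2))" by blast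
  qed
  moreover have "\<exists>w. (\<lambda>n. LINT x|m. (En a n (w n) x - u x)\<^sup>2) \<longlonglongrightarrow> 0"
  proof (rule exists_minimising_sequence)
    fix e :: real assume "e > 0"
    then have e: "e/4 > 0" by simp
    \<comment> \<open>The approximant h depends on e but not on n, so its samples are good for all
      large n; squaring the sum of two errors doubles each, whence e/4.\<close>
    obtain h where h: "continuous_on {0..1} h" "(LINT x|m. (u x - h x)\<^sup>2) < e/4"
      using continuous_dense_L2[OF u e] by blast
    show "\<forall>\<^sub>F n in sequentially. \<exists>v. (LINT x|m. (En a n v x - u x)\<^sup>2) < e"
      using order_tendstoD(2)[OF integral_En_samples[OF h(1)] e] eventually_ge_at_top[of 1]
    proof eventually_elim
      case (elim n)
      let ?v = "\<lambda>i. h (a n i)"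
      have "(LINT x|m. ((En a n ?v x - h x) + (-1) * (u x - h x))\<^sup>2)
          \<le> 2 * (LINT x|m. (En a n ?v x - h x)\<^sup>2) + 2 * (LINT x|m. ((-1) * (u x - h x))\<^sup>2)"
        by (intro L2_square_add_le L2_diff L2_cmult L2_En elim u L2_continuous h)
      also have "(\<lambda>x. ((-1) * (u x - h x))\<^sup>2) = (\<lambda>x. (u x - h x)\<^sup>2)"
        by (simp add: power2_commute)
      also have "2 * (LINT x|m. (En a n ?v x - h x)\<^sup>2) + 2 * (LINT x|m. (u x - h x)\<^sup>2) < e"
        using elim(1) h(2) by linarith
      finally show ?case by (auto simp: algebra_simps)
    qed
  qed simp
  ultimately show ?thesis by simp
qed

end

theorem theorem3p1:
  fixes m :: "real measure" and s :: "real \<Rightarrow> real" and a :: "nat \<Rightarrow> nat \<Rightarrow> real"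
  assumes space_m: "space m = {0..1}"
    and sets_m: "sets m = sets (restrict_space borel {0..1})"
    and finite_m: "finite_measure m"
    and full_support: "\<forall>x\<in>{0..1}. \<forall>e>0. emeasure m (ball x e \<inter> {0..1}) > 0"
    and s_cont: "continuous_on {0..1} s"
    and s_mono: "strict_mono_on {0..1} s"
    and a_first: "\<forall>n\<ge>1. a n 1 = 0"
    and a_last: "\<forall>n\<ge>1. a n (Suc n) = 1"
    and a_incr: "\<forall>n\<ge>1. \<forall>i\<in>{1..n}. a n i < a n (Suc i)"
    and mesh: "(\<lambda>n. Max ((\<lambda>i. a n (Suc i) - a n i) ` {1..n})) \<longlonglongrightarrow> 0"
  shows "(\<forall>(v :: nat \<Rightarrow> nat \<Rightarrow> real) u. L2 m u \<longrightarrow>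
            (\<forall>g. L2 m g \<longrightarrow>
               (\<lambda>n. LINT x|m. En a n (v n) x * g x) \<longlonglongrightarrow> (LINT x|m. u x * g x)) \<longrightarrow>
            liminf (\<lambda>n. En_energy a s n (v n)) \<ge> Es_energy m s u)
       \<and> (\<forall>u. L2 m u \<longrightarrow>
            (\<exists>w :: nat \<Rightarrow> nat \<Rightarrow> real.
               (\<lambda>n. LINT x|m. (En a n (w n) x - u x)^2) \<longlonglongrightarrow> 0 \<and>
               limsup (\<lambda>n. En_energy a s n (w n)) \<le> Es_energy m s u))"
proof -
  have "scale s" by (rule scale.intro[OF s_cont s_mono])
  moreover have "partitions a"
    by (rule partitions.intro) (use a_first a_last a_incr mesh in blast)+
  moreover have "finite_borel_unit m" by (rule finite_borel_unit.intro[OF finite_m sets_m])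
  moreover have "mosco_axioms m" by (rule mosco_axioms.intro) (use full_support in blast)
  ultimately interpret mosco s a m by (intro mosco.intro discrete_forms.intro)
  show ?thesis
    using liminf_inequality recovery_sequence by blast
qed

end
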